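(* Let $n\ge 1$ and let $f:\mathbb R^n\to\mathbb R$ satisfy the standing assumptions (A1)–(A3) stated in the context, with exponent $a\in[1,2]$ from (A2). Let $\{x_t\}$ be any family of global minimizers, $x_t\in\operatorname*{arg\,min}_{x\in\mathbb R^n}P_tf$. Then there exists $t_0>0$ such that for every $0<t<t_0$ the Hessian $\nabla_x^2(P_tf)(x_t)$ is positive definite. More precisely: \begin{itemize} \item If $a=2$, then there exists $c_0>0$ such that $\nabla_x^2(P_tf)(x_t)\succeq c_0 I$ for all $0<t<t_0$. \item If $1\le a<2$, then there exists $c_0>0$ such that $\nabla_x^2(P_tf)(x_t)\succeq c_0\,t^{(a-2)/2}I$ for all $0<t<t_0$. \end{itemize}
   Context: Notation: $\|\cdot\|_2$ is the Euclidean norm on $\mathbb R^n$ and $B_\rho(0)=\{x:\|x\|_2<\rho\}$. For $t>0$ the heat kernel is $G_t(y)=\frac{1}{(4\pi t)^{n/2}}e^{-\|y\|_2^2/(4t)}$, and the heat-kernel regularization of $f$ is $(P_tf)(x)=\int_{\mathbb R^n}G_t(x-y)f(y)\,dy$. $\nabla_x^2$ denotes the Hessian in $x$, $I$ the identity matrix, and $A\succeq B$ means $A-B$ is positive semidefinite. For $a\in[1,2]$, $\Phi_a(x)=\sum_{i=1}^n|x_i|^a$. Standing assumptions on the (Lebesgue measurable) function $f:\mathbb R^n\to\mathbb R$: (A1) Global quadratic lower bound: there is a constant $c>0$ with $f(x)\ge c\|x\|_2^2$ for all $x\in\mathbb R^n$. The distinguished minimizer is at the origin, with $f(0)=0$.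 (A2) Local leading-order profile: there exist $a\in[1,2]$, $r_0>0$, a function $r:\mathbb R^n\to\mathbb R$ and a function $\omega:[0,r_0)\to[0,\infty)$ with $\lim_{\rho\to0^+}\omega(\rho)=0$ such that $f(x)=\Phi_a(x)+r(x)$ and $|r(x)|\le\omega(\|x\|_2)\,\Phi_a(x)$ for all $x\in B_{r_0}(0)$. (A3) Polynomial tail control: there exist constants $C>0$ and $m\ge2$ such that $f(x)\le C(1+\|x\|_2^m)$ for all $x\in\mathbb R^n$. *)

theory Defs
  imports "HOL-Analysis.Analysis"
begin

definition heat_kernel :: "real \<Rightarrow> real ^ 'n::finite \<Rightarrow> real" where
  "heat_kernel t y =
     1 / (4 * pi * t) powr (real CARD('n) / 2) * exp (- (norm y)\<^sup>2 / (4 * t))"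

definition heat_reg :: "real \<Rightarrow> (real ^ 'n::finite \<Rightarrow> real) \<Rightarrow> real ^ 'n \<Rightarrow> real" where
  "heat_reg t f x = (LINT y|lebesgue. heat_kernel t (x - y) * f y)"

definition partial_deriv :: "'n::finite \<Rightarrow> (real ^ 'n \<Rightarrow> real) \<Rightarrow> real ^ 'n \<Rightarrow> real" where
  "partial_deriv i g x = deriv (\<lambda>s. g (x + s *\<^sub>R axis i 1)) 0"

definition hessian :: "(real ^ 'n::finite \<Rightarrow> real) \<Rightarrow> real ^ 'n \<Rightarrow> real ^ 'n ^ 'n" where
  "hessian g x = (\<chi> i j. partial_deriv i (partial_deriv j g) x)"

text \<open>Definiteness is understood, as usual, for symmetric matrices; symmetry is part of both
  notions.\<close>

definition pos_def :: "real ^ 'n::finite ^ 'n \<Rightarrow> bool" where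
  "pos_def A \<longleftrightarrow> transpose A = A \<and> (\<forall>v. v \<noteq> 0 \<longrightarrow> v \<bullet> (A *v v) > 0)"

definition pos_semidef :: "real ^ 'n::finite ^ 'n \<Rightarrow> bool" where
  "pos_semidef A \<longleftrightarrow> transpose A = A \<and> (\<forall>v. v \<bullet> (A *v v) \<ge> 0)"

definition loewner_ge :: "real ^ 'n::finite ^ 'n \<Rightarrow> real ^ 'n ^ 'n \<Rightarrow> bool"  (infix "\<succeq>" 50) where
  "A \<succeq> B \<longleftrightarrow> pos_semidef (A - B)"

definition Phi :: "real \<Rightarrow> real ^ 'n::finite \<Rightarrow> real" where
  "Phi a x = (\<Sum>i\<in>UNIV. \<bar>x $ i\<bar> powr a)"

text \<open>Together with \<^term>\<open>f 0 = 0\<close>, the quadratic bound makes the origin the unique global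
  minimizer of \<^term>\<open>f\<close>.\<close>

definition quadratic_lower_bound :: "(real ^ 'n::finite \<Rightarrow> real) \<Rightarrow> bool" where
  "quadratic_lower_bound f \<longleftrightarrow> f 0 = 0 \<and> (\<exists>c>0. \<forall>x. f x \<ge> c * (norm x)\<^sup>2)"

text \<open>The function \<open>\<omega>\<close> is only relevant on \<open>[0, r0)\<close>.\<close>

definition local_profile :: "real \<Rightarrow> (real ^ 'n::finite \<Rightarrow> real) \<Rightarrow> bool" where
  "local_profile a f \<longleftrightarrow> 1 \<le> a \<and> a \<le> 2 \<and>
     (\<exists>(r0::real) (r :: real ^ 'n \<Rightarrow> real) (\<omega> :: real \<Rightarrow> real).
        r0 > 0 \<and> (\<forall>\<rho>\<in>{0..<r0}. \<omega> \<rho> \<ge> 0) \<and> (\<omega> \<longlongrightarrow> 0) (at_right 0) \<and>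
        (\<forall>x\<in>ball 0 r0. f x = Phi a x + r x \<and> \<bar>r x\<bar> \<le> \<omega> (norm x) * Phi a x))"

definition polynomial_tail :: "(real ^ 'n::finite \<Rightarrow> real) \<Rightarrow> bool" where
  "polynomial_tail f \<longleftrightarrow>
     (\<exists>C>0. \<exists>m\<ge>2. \<forall>x. f x \<le> C * (1 + norm x powr m))"

end

theory Submission
  imports Defs "HOL-Probability.Distributions"
begin

text \<open>
  With \<open>s = sqrt t\<close>, the rescaled functions \<open>g\<^sub>s(y) = s\<^bsup>-a\<^esup> f(s y)\<close> converge pointwise to \<open>\<Phi>\<^sub>a\<close> as
  \<open>s \<rightarrow> 0\<close> and have uniform polynomial growth, and the Hessian of \<open>P\<^sub>t f\<close> at \<open>s \<xi>\<close> is \<open>s\<^bsup>a-2\<^esup>\<close> times the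
  Hessian of \<open>P\<^sub>1 g\<^sub>s\<close> at \<open>\<xi>\<close>.  A lower bound \<open>g\<^sub>s(y) \<ge> k (\<bar>y\<bar> - n)\<close> uniform in \<open>s\<close> confines the rescaled
  minimizers to a fixed ball.  By compactness and dominated convergence it is then enough that the
  Hessian of \<open>P\<^sub>1 \<Phi>\<^sub>a\<close> is positive definite at every point.  It is diagonal because \<open>\<Phi>\<^sub>a\<close> is a sum of
  functions of one coordinate, and its diagonal entries are positive by convexity of \<open>\<bar>u\<bar>\<^bsup>a\<^esup>\<close>.
\<close>

section \<open>Affine substitutions and Gaussian integrals\<close>

text \<open>\<open>f\<close> is only measurable, and for \<open>a < 2\<close> the limit
  \<open>Phi a\<close> is not twice differentiable on the coordinate hyperplanes, so every
  derivative is placed on the kernel. Limits then require only pointwise convergence and one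
  Gaussian majorant. Confining the minimizers is essential: for \<open>a < 2\<close> the k-th
  diagonal entry of the limiting Hessian is positive but tends to zero as the k-th coordinate of the
  point grows, so no positive lower bound holds uniformly on the whole space. The quadratic lower
  bound alone does not confine them, because rescaling turns its constant into
  \<open>c * s powr (2 - a)\<close>, which degenerates as \<open>s\<close> tends to 0. Near the
  origin the local profile takes over; since \<open>a \<ge> 1\<close> it grows at least linearly,
  which explains the linear form of the uniform bound. The family of minimizers carries no
  regularity in \<open>t\<close>, so uniformity is extracted from sequences, and the resulting
  constants are not explicit.\<close>

lemma
  fixes h :: "real ^ 'n::finite \<Rightarrow> real"
  assumes [measurable]: "h \<in> borel_measurable lebesgue" and "c \<noteq> 0"
  shows lebesgue_measurable_affine: "(\<lambda>y. h (u + c *\<^sub>R y)) \<in> borel_measurable lebesgue"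
    and lebesgue_integral_affine:
      "(LINT y|lebesgue. h y) = \<bar>c\<bar> ^ CARD('n) * (LINT y|lebesgue. h (u + c *\<^sub>R y))"
proof -
  \<comment> \<open>The change of variables is available for affine maps that are diagonal in the
    basis; \<open>T\<close> identifies the case of equal factors with
    \<open>u + c *\<^sub>R y\<close>.\<close>
  have T: "u + (\<Sum>j\<in>Basis. (c * (y \<bullet> j)) *\<^sub>R j) = u + c *\<^sub>R y" for y :: "real ^ 'n"
    by (simp flip: scaleR_scaleR scaleR_sum_right add: euclidean_representation)
  have [measurable]: "(\<lambda>y. u + c *\<^sub>R y) \<in> lebesgue \<rightarrow>\<^sub>M lebesgue"
    using lebesgue_affine_measurable[of "\<lambda>_. c" u] \<open>c \<noteq> 0\<close> by (simp add: T)
  show "(\<lambda>y. h (u + c *\<^sub>R y)) \<in> borel_measurable lebesgue"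
    by measurable
  have "(LINT y|lebesgue. h y)
      = (LINT y|density (distr lebesgue lebesgue (\<lambda>y. u + c *\<^sub>R y)) (\<lambda>_. ennreal (\<bar>c\<bar> ^ CARD('n))). h y)"
    using lebesgue_affine_euclidean[of "\<lambda>_. c" u] \<open>c \<noteq> 0\<close> by (simp add: T)
  also have "\<dots> = \<bar>c\<bar> ^ CARD('n) * (LINT y|lebesgue. h (u + c *\<^sub>R y))"
    by (subst integral_density) (auto simp: integral_distr)
  finally show "(LINT y|lebesgue. h y) = \<bar>c\<bar> ^ CARD('n) * (LINT y|lebesgue. h (u + c *\<^sub>R y))" .
qed

lemma borel_measurable_lebesgue_if_borel:
  fixes h :: "real ^ 'n::finite \<Rightarrow> real"
  shows "h \<in> borel_measurable borel \<Longrightarrow> h \<in> borel_measurable lebesgue"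
  by (simp add: measurable_completion)

text \<open>The integrand is a product over coordinates, and each factor is a multiple of a normal
  density.\<close>

lemma integrable_gaussian:
  fixes \<alpha> :: real
  assumes "\<alpha> > 0"
  shows "integrable lebesgue (\<lambda>y :: real ^ 'n::finite. exp (- \<alpha> * (norm y)\<^sup>2))"
proof -
  have 1: "integrable lborel (\<lambda>x::real. exp (- \<alpha> * x\<^sup>2))"
  proof -
    \<comment> \<open>Chosen so that the exponent of the normal density, with coefficient
      \<open>1 / (2 * \<sigma>\<^sup>2)\<close>, is the given one.\<close>
    define \<sigma> where "\<sigma> = 1 / sqrt (2 * \<alpha>)"
    have \<sigma>: "\<sigma> > 0" "\<sigma>\<^sup>2 = 1 / (2 * \<alpha>)"
      using assms by (auto simp: \<sigma>_def power_divide)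
    have "integrable lborel (\<lambda>x. sqrt (2 * pi * \<sigma>\<^sup>2) * normal_density 0 \<sigma> x)"
      using \<sigma> by (intro integrable_mult_right integrable_normal_density)
    also have "(\<lambda>x. sqrt (2 * pi * \<sigma>\<^sup>2) * normal_density 0 \<sigma> x) = (\<lambda>x. exp (- \<alpha> * x\<^sup>2))"
      using \<sigma> assms by (auto simp: normal_density_def field_simps)
    finally show ?thesis .
  qed
  have eq: "ennreal (exp (- \<alpha> * (norm y)\<^sup>2)) = (\<Prod>b\<in>Basis. ennreal (exp (- \<alpha> * (y \<bullet> b)\<^sup>2)))"
    for y :: "real ^ 'n"
    by (simp add: prod_ennreal euclidean_dist_l2 power2_norm_eq_inner euclidean_inner[of y y]
        sum_negf sum_distrib_left flip: exp_sum power2_eq_square)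
  have "(\<integral>\<^sup>+y. ennreal (exp (- \<alpha> * (norm y)\<^sup>2)) \<partial>(lborel :: (real^'n) measure))
      = (\<Prod>b\<in>(Basis :: (real^'n) set). (\<integral>\<^sup>+x. ennreal (exp (- \<alpha> * x\<^sup>2)) \<partial>lborel))"
    unfolding eq by (rule nn_integral_lborel_prod) auto
  also have "\<dots> < \<infinity>"
    using 1 by (auto simp: integrable_iff_bounded ennreal_prod_eq_top less_top[symmetric] power_eq_top_ennreal)
  finally have "integrable lborel (\<lambda>y :: real ^ 'n. exp (- \<alpha> * (norm y)\<^sup>2))"
    by (intro integrableI_bounded) auto
  then show ?thesis
    by (subst integrable_completion) auto
qed

text \<open>A real exponent is raised to an even integer \<open>2 * M\<close>, and
  \<open>(1 + x / M) ^ M \<le> exp x\<close> with \<open>x = b * u\<^sup>2\<close> controls that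
  power. In \<open>B\<close>, the summand 2 pays for two constants 1 and
  \<open>(real M / b) ^ M\<close> for the power.\<close>

lemma powr_le_exp:
  fixes m b :: real
  assumes "b > 0" "m \<ge> 0"
  obtains B where "B > 0" "\<And>u. u \<ge> 0 \<Longrightarrow> 1 + u powr m \<le> B * exp (b * u\<^sup>2)"
proof -
  \<comment> \<open>The additional 1 keeps \<open>M\<close> positive when \<open>m = 0\<close>,
    since \<open>M\<close> becomes a denominator.\<close>
  define M where "M = nat \<lceil>m\<rceil> + 1"
  have Mm: "m \<le> 2 * real M" using real_nat_ceiling_ge[of m] by (simp add: M_def del: of_nat_nat)
  have "M > 0" by (simp add: M_def)
  define B where "B = 2 + (real M / b) ^ M"
  show ?thesis
  proof
    show "B > 0" using assms by (auto simp: B_def intro!: add_pos_nonneg)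
    fix u :: real assume "u \<ge> 0"
    have 1: "u powr m \<le> 1 + u ^ (2 * M)"
    proof (cases "u \<le> 1")
      case True
      then show ?thesis
        using \<open>u \<ge> 0\<close> assms powr_le1[of m u] zero_le_power[of u "2 * M"] by linarith
    next
      case False
      then have "u powr m \<le> u powr (2 * real M)" using Mm by (intro powr_mono) auto
      also have "\<dots> = u ^ (2 * M)" using False by (subst powr_realpow[symmetric]) auto
      finally show ?thesis by simp
    qed
    have bu: "b * u\<^sup>2 \<ge> 0" using assms by simp
    have "(b * u\<^sup>2 / real M) ^ M \<le> (1 + b * u\<^sup>2 / real M) ^ M"
      using bu by (intro power_mono) auto
    also have "\<dots> \<le> exp (b * u\<^sup>2)"
      using Mm assms bu \<open>M > 0\<close> by (intro exp_ge_one_plus_x_over_n_power_n) linarith+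
    finally have "(u\<^sup>2) ^ M \<le> (real M / b) ^ M * exp (b * u\<^sup>2)"
      using assms \<open>M > 0\<close> by (simp add: field_simps power_mult_distrib)
    then have "u ^ (2 * M) \<le> (real M / b) ^ M * exp (b * u\<^sup>2)"
      by (simp only: power_mult)
    moreover have "1 \<le> exp (b * u\<^sup>2)" using assms by simp
    ultimately show "1 + u powr m \<le> B * exp (b * u\<^sup>2)"
      using 1 unfolding B_def distrib_right by linarith
  qed
qed

section \<open>The heat kernel and its derivatives\<close>

definition heat_kernel_grad :: "'n::finite \<Rightarrow> real ^ 'n \<Rightarrow> real" where
  "heat_kernel_grad j z = - (z $ j / 2) * heat_kernel 1 z"

definition heat_kernel_hess :: "'n::finite \<Rightarrow> 'n \<Rightarrow> real ^ 'n \<Rightarrow> real" where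
  "heat_kernel_hess i j z = (z $ i * z $ j / 4 - (if i = j then 1 / 2 else 0)) * heat_kernel 1 z"

lemma heat_kernel_pos: "t > 0 \<Longrightarrow> heat_kernel t z > 0"
  by (simp add: heat_kernel_def)

lemma heat_kernel_minus: "heat_kernel t (- z) = heat_kernel t z"
  by (simp add: heat_kernel_def)

lemma continuous_on_heat_kernel [continuous_intros]:
  "continuous_on A g \<Longrightarrow> t > 0 \<Longrightarrow> continuous_on A (\<lambda>z. heat_kernel t (g z))"
  unfolding heat_kernel_def by (intro continuous_intros) auto

lemma continuous_on_heat_kernel_grad: "continuous_on A (heat_kernel_grad j)"
  unfolding heat_kernel_grad_def by (intro continuous_intros) auto

lemma continuous_on_heat_kernel_hess: "continuous_on A (heat_kernel_hess i j)"
  unfolding heat_kernel_hess_def by (intro continuous_intros) auto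

lemma DERIV_heat_kernel:
  "((\<lambda>s. heat_kernel 1 (z + s *\<^sub>R axis j 1)) has_real_derivative
     heat_kernel_grad j (z + s *\<^sub>R axis j 1)) (at s)"
proof -
  have n: "(norm (z + s *\<^sub>R axis j 1))\<^sup>2 = (norm z)\<^sup>2 + 2 * s * z $ j + s\<^sup>2" for s
    unfolding power2_norm_eq_inner
    by (simp add: inner_simps inner_axis inner_axis' power2_eq_square algebra_simps)
  show ?thesis
    unfolding heat_kernel_grad_def heat_kernel_def n
    by (auto intro!: derivative_eq_intros simp: field_simps)
qed

lemma DERIV_heat_kernel_grad:
  "((\<lambda>s. heat_kernel_grad j (z + s *\<^sub>R axis i 1)) has_real_derivative
     heat_kernel_hess i j (z + s *\<^sub>R axis i 1)) (at s)"
proof -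
  let ?w = "z + s *\<^sub>R axis i 1"
  \<comment> \<open>Along axis \<open>i\<close> the prefactor \<open>z $ j\<close> varies only if
    \<open>i = j\<close>; this is the origin of the 1/2 in \<open>heat_kernel_hess\<close>.\<close>
  have "((\<lambda>s. - ((z $ j + s * (if i = j then 1 else 0)) / 2) * heat_kernel 1 (z + s *\<^sub>R axis i 1))
      has_real_derivative - ((if i = j then 1 else 0) / 2) * heat_kernel 1 ?w
        + heat_kernel_grad i ?w * - ((z $ j + s * (if i = j then 1 else 0)) / 2)) (at s)"
    by (rule DERIV_mult[OF _ DERIV_heat_kernel]) (auto intro!: derivative_eq_intros)
  moreover have w: "(z + s *\<^sub>R axis i 1) $ j = z $ j + s * (if i = j then 1 else 0)" for s
    by (simp add: axis_def)
  moreover have "- ((if i = j then 1 else 0) / 2) * heat_kernel 1 ?w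
      + heat_kernel_grad i ?w * - ((z $ j + s * (if i = j then 1 else 0)) / 2) = heat_kernel_hess i j ?w"
    unfolding heat_kernel_hess_def heat_kernel_grad_def w[of s] by (simp add: field_simps)
  ultimately show ?thesis
    unfolding heat_kernel_grad_def[of j] w by (simp only:)
qed

text \<open>A common class for the kernel, its gradient and its Hessian entries, so that domination
  and differentiation under the integral are proved once. The weight is quadratic because the
  Hessian entries carry a quadratic polynomial.\<close>

definition heat_bounded :: "(real ^ 'n::finite \<Rightarrow> real) \<Rightarrow> bool" where
  "heat_bounded q \<longleftrightarrow> continuous_on UNIV q \<and>
     (\<forall>z. \<bar>q z\<bar> \<le> (1 + (norm z)\<^sup>2) * heat_kernel 1 z)"

lemma heat_bounded_heat_kernel: "heat_bounded (heat_kernel 1)"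
  unfolding heat_bounded_def
  by (auto intro!: continuous_intros simp: abs_of_pos heat_kernel_pos distrib_right
      zero_le_mult_iff less_imp_le)

lemma heat_bounded_heat_kernel_grad: "heat_bounded (heat_kernel_grad j)"
proof -
  have "\<bar>z $ j / 2\<bar> \<le> 1 + (norm z)\<^sup>2" for z :: "real ^ 'a"
  proof -
    have "\<bar>z $ j\<bar> \<le> norm z" by (rule component_le_norm_cart)
    moreover have "norm z \<le> 1 + (norm z)\<^sup>2"
      using zero_le_power2[of "norm z - 1/2"] by (simp add: power2_eq_square algebra_simps)
    ultimately show ?thesis by simp
  qed
  then have "\<bar>heat_kernel_grad j z\<bar> \<le> (1 + (norm z)\<^sup>2) * heat_kernel 1 z" for z
    unfolding heat_kernel_grad_def abs_mult abs_minus_cancel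
    by (intro mult_mono) (auto simp: abs_of_pos heat_kernel_pos less_imp_le)
  then show ?thesis
    by (simp add: heat_bounded_def continuous_on_heat_kernel_grad)
qed

lemma heat_bounded_heat_kernel_hess: "heat_bounded (heat_kernel_hess i j)"
proof -
  have "\<bar>z $ i * z $ j / 4 - (if i = j then 1 / 2 else 0)\<bar> \<le> 1 + (norm z)\<^sup>2" for z :: "real ^ 'a"
  proof -
    have "\<bar>z $ i * z $ j\<bar> \<le> norm z * norm z"
      unfolding abs_mult by (intro mult_mono component_le_norm_cart) auto
    moreover have "norm z * norm z \<ge> 0" by simp
    moreover define d where "d = (if i = j then 1 / 2 else 0 :: real)"
    moreover have "0 \<le> d" "d \<le> 1 / 2" by (auto simp: d_def)
    ultimately show ?thesis unfolding power2_eq_square d_def[symmetric] by linarith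
  qed
  then have "\<bar>heat_kernel_hess i j z\<bar> \<le> (1 + (norm z)\<^sup>2) * heat_kernel 1 z" for z
    unfolding heat_kernel_hess_def abs_mult
    by (intro mult_mono) (auto simp: abs_of_pos heat_kernel_pos less_imp_le)
  then show ?thesis
    by (simp add: heat_bounded_def continuous_on_heat_kernel_hess)
qed

text \<open>\<open>A\<close> is chosen before \<open>q\<close>, \<open>g\<close> and
  \<open>\<xi>\<close>, so a single integrable majorant serves whole sequences. The rate starts at
  1/4: absorbing the quadratic weight leaves 1/8, passing from \<open>\<xi> - \<eta>\<close> to
  \<open>\<eta>\<close> halves it to 1/16, and the growth of \<open>g\<close> costs 1/32.\<close>

lemma heat_bounded_gaussian_bound:
  fixes K m R :: real
  assumes "m \<ge> 0" "K \<ge> 0"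
  shows "\<exists>A. \<forall>q g (\<xi> :: real ^ 'n::finite) \<eta>. heat_bounded q \<longrightarrow> norm \<xi> \<le> R \<longrightarrow>
    \<bar>g \<eta>\<bar> \<le> K * (1 + norm \<eta> powr m) \<longrightarrow>
    \<bar>q (\<xi> - \<eta>) * g \<eta>\<bar> \<le> A * exp (- (1 / 32) * (norm \<eta>)\<^sup>2)"
proof -
  obtain B where B: "B > 0" "\<And>u. u \<ge> 0 \<Longrightarrow> 1 + u powr m \<le> B * exp (1 / 32 * u\<^sup>2)"
    using powr_le_exp[of "1 / 32" m] assms by auto
  define c where "c = 1 / (4 * pi) powr (real CARD('n) / 2)"
  have c: "c > 0" by (simp add: c_def)
  show ?thesis
  proof (intro exI allI impI)
    fix q g :: "real ^ 'n \<Rightarrow> real" and \<xi> \<eta> :: "real ^ 'n"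
    assume q: "heat_bounded q" and R: "norm \<xi> \<le> R" and g: "\<bar>g \<eta>\<bar> \<le> K * (1 + norm \<eta> powr m)"
    define z where "z = \<xi> - \<eta>"
    have "(norm \<eta>)\<^sup>2 \<le> 2 * (norm z)\<^sup>2 + 2 * (norm \<xi>)\<^sup>2"
    proof -
      have "norm \<eta> \<le> norm z + norm \<xi>"
        using norm_triangle_ineq4[of \<xi> z] by (simp add: z_def)
      then have "(norm \<eta>)\<^sup>2 \<le> (norm z + norm \<xi>)\<^sup>2" by (intro power_mono) auto
      also have "\<dots> \<le> 2 * (norm z)\<^sup>2 + 2 * (norm \<xi>)\<^sup>2"
        using zero_le_power2[of "norm z - norm \<xi>"] by (simp add: power2_eq_square algebra_simps)
      finally show ?thesis .
    qed
    moreover have "(norm \<xi>)\<^sup>2 \<le> R\<^sup>2" using R by (intro power_mono) auto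
    ultimately have z: "(norm z)\<^sup>2 \<ge> (norm \<eta>)\<^sup>2 / 2 - R\<^sup>2" by linarith
    have one_plus_le: "1 + (norm z)\<^sup>2 \<le> 8 * exp ((norm z)\<^sup>2 / 8)"
      using exp_ge_add_one_self[of "(norm z)\<^sup>2 / 8"] by linarith
    have "\<bar>q z\<bar> \<le> (1 + (norm z)\<^sup>2) * heat_kernel 1 z"
      using q by (simp add: heat_bounded_def)
    also have "\<dots> \<le> (8 * exp ((norm z)\<^sup>2 / 8)) * heat_kernel 1 z"
      using one_plus_le
      by (intro mult_right_mono) (simp_all add: heat_kernel_pos less_imp_le)
    also have "\<dots> = 8 * c * exp (- (norm z)\<^sup>2 / 8)"
      by (simp add: heat_kernel_def c_def mult_exp_exp)
    also have "\<dots> \<le> 8 * c * exp (R\<^sup>2 / 8 - (norm \<eta>)\<^sup>2 / 16)"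
      using z c by (intro mult_left_mono) auto
    finally have 1: "\<bar>q z\<bar> \<le> 8 * c * exp (R\<^sup>2 / 8 - (norm \<eta>)\<^sup>2 / 16)" .
    have 2: "\<bar>g \<eta>\<bar> \<le> K * (B * exp (1 / 32 * (norm \<eta>)\<^sup>2))"
      using g B(2)[of "norm \<eta>"] assms by (meson mult_left_mono norm_ge_zero order_trans)
    have "\<bar>q z * g \<eta>\<bar> \<le> (8 * c * exp (R\<^sup>2 / 8 - (norm \<eta>)\<^sup>2 / 16)) * (K * (B * exp (1 / 32 * (norm \<eta>)\<^sup>2)))"
      unfolding abs_mult using 1 2 c by (intro mult_mono) auto
    also have "\<dots> = (8 * c * K * B) * exp (R\<^sup>2 / 8 - (norm \<eta>)\<^sup>2 / 16 + 1 / 32 * (norm \<eta>)\<^sup>2)"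
      by (simp only: exp_add mult_ac)
    also have "R\<^sup>2 / 8 - (norm \<eta>)\<^sup>2 / 16 + 1 / 32 * (norm \<eta>)\<^sup>2 = R\<^sup>2 / 8 + - (1 / 32) * (norm \<eta>)\<^sup>2"
      by simp
    also have "8 * c * K * B * exp \<dots> = (8 * c * K * B * exp (R\<^sup>2 / 8)) * exp (- (1 / 32) * (norm \<eta>)\<^sup>2)"
      by (simp only: exp_add mult_ac)
    finally show "\<bar>q (\<xi> - \<eta>) * g \<eta>\<bar> \<le> (8 * c * K * B * exp (R\<^sup>2 / 8)) * exp (- (1 / 32) * (norm \<eta>)\<^sup>2)"
      by (simp add: z_def)
  qed
qed

lemma borel_measurable_heat_bounded:
  assumes "heat_bounded q" shows "(\<lambda>\<eta>. q (\<xi> - \<eta>)) \<in> borel_measurable lebesgue"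
proof (rule borel_measurable_lebesgue_if_borel, rule borel_measurable_continuous_onI)
  have "continuous_on UNIV q" using assms by (simp add: heat_bounded_def)
  then show "continuous_on UNIV (\<lambda>\<eta>. q (\<xi> - \<eta>))"
    by (rule continuous_on_compose2) (auto intro!: continuous_intros)
qed

lemma integrable_heat_bounded:
  fixes g :: "real ^ 'n::finite \<Rightarrow> real"
  assumes q: "heat_bounded q" and g: "g \<in> borel_measurable lebesgue"
    and b: "\<And>\<eta>. \<bar>g \<eta>\<bar> \<le> K * (1 + norm \<eta> powr m)" and "m \<ge> 0"
  shows "integrable lebesgue (\<lambda>\<eta>. q (\<xi> - \<eta>) * g \<eta>)"
proof -
  \<comment> \<open>At the origin the growth bound reads \<open>\<bar>g 0\<bar> \<le> K\<close>,
    because \<open>0 powr m = 0\<close>, even for \<open>m = 0\<close>.\<close>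
  have "K \<ge> 0" using order_trans[OF abs_ge_zero b[of 0]] by simp
  from heat_bounded_gaussian_bound[OF \<open>m \<ge> 0\<close> this, of "norm \<xi>", where 'n = 'n]
  obtain A where "\<bar>q (\<xi> - \<eta>) * g \<eta>\<bar> \<le> A * exp (- (1 / 32) * (norm \<eta>)\<^sup>2)" for \<eta>
    using b q by blast
  then have A: "norm (q (\<xi> - \<eta>) * g \<eta>) \<le> norm (A * exp (- (1 / 32) * (norm \<eta>)\<^sup>2))" for \<eta>
    by (metis abs_ge_self order_trans real_norm_def)
  show ?thesis
  proof (rule Bochner_Integration.integrable_bound)
    show "integrable lebesgue (\<lambda>\<eta> :: real ^ 'n. A * exp (- (1 / 32) * (norm \<eta>)\<^sup>2))"
      by (intro integrable_mult_right integrable_gaussian) auto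
    show "(\<lambda>\<eta>. q (\<xi> - \<eta>) * g \<eta>) \<in> borel_measurable lebesgue"
      by (intro borel_measurable_times g borel_measurable_heat_bounded q)
    show "AE \<eta> in lebesgue. norm (q (\<xi> - \<eta>) * g \<eta>) \<le> norm (A * exp (- (1 / 32) * (norm \<eta>)\<^sup>2))"
      using A by (intro AE_I2)
  qed
qed

text \<open>The evaluation point and the integrated function may move together: a convergent
  sequence of points is bounded, so the Gaussian majorant can be taken for one radius
  \<open>R\<close>.\<close>

lemma tendsto_heat_bounded_integral:
  fixes g :: "real ^ 'n::finite \<Rightarrow> real"
  assumes q: "heat_bounded q"
    and G: "\<And>k. G k \<in> borel_measurable lebesgue" and g: "g \<in> borel_measurable lebesgue"
    and b: "\<And>k \<eta>. \<bar>G k \<eta>\<bar> \<le> K * (1 + norm \<eta> powr m)" and "m \<ge> 0"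
    and lim: "\<And>\<eta>. (\<lambda>k. G k \<eta>) \<longlonglongrightarrow> g \<eta>" and \<xi>: "\<xi> \<longlonglongrightarrow> \<xi>'"
  shows "(\<lambda>k. LINT \<eta>|lebesgue. q (\<xi> k - \<eta>) * G k \<eta>) \<longlonglongrightarrow> (LINT \<eta>|lebesgue. q (\<xi>' - \<eta>) * g \<eta>)"
proof -
  have "K \<ge> 0" using order_trans[OF abs_ge_zero b[of undefined 0]] by simp
  from \<xi> have "Bseq \<xi>" by (intro convergent_imp_Bseq convergentI)
  then obtain R where R: "\<And>k. norm (\<xi> k) \<le> R" by (auto simp: Bseq_def)
  from heat_bounded_gaussian_bound[OF \<open>m \<ge> 0\<close> \<open>K \<ge> 0\<close>, of R, where 'n = 'n]
  obtain A where A: "\<bar>q (\<xi> k - \<eta>) * G k \<eta>\<bar> \<le> A * exp (- (1 / 32) * (norm \<eta>)\<^sup>2)" for k \<eta>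
    using b q R by blast
  show ?thesis
  proof (rule integral_dominated_convergence)
    show "(\<lambda>\<eta>. q (\<xi>' - \<eta>) * g \<eta>) \<in> borel_measurable lebesgue"
      by (intro borel_measurable_times g borel_measurable_heat_bounded q)
    show "(\<lambda>\<eta>. q (\<xi> k - \<eta>) * G k \<eta>) \<in> borel_measurable lebesgue" for k
      by (intro borel_measurable_times G borel_measurable_heat_bounded q)
    show "integrable lebesgue (\<lambda>\<eta> :: real ^ 'n. A * exp (- (1 / 32) * (norm \<eta>)\<^sup>2))"
      by (intro integrable_mult_right integrable_gaussian) auto
    show "AE \<eta> in lebesgue. norm (q (\<xi> k - \<eta>) * G k \<eta>) \<le> A * exp (- (1 / 32) * (norm \<eta>)\<^sup>2)" for k
      using A by (intro AE_I2) (simp only: real_norm_def)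
    have "(\<lambda>k. q (\<xi> k - \<eta>)) \<longlonglongrightarrow> q (\<xi>' - \<eta>)" for \<eta>
      using q unfolding heat_bounded_def
      by (auto intro!: continuous_on_tendsto_compose[of UNIV q] tendsto_diff \<xi>)
    then show "AE \<eta> in lebesgue. (\<lambda>k. q (\<xi> k - \<eta>) * G k \<eta>) \<longlonglongrightarrow> q (\<xi>' - \<eta>) * g \<eta>"
      using lim by (intro AE_I2 tendsto_mult)
  qed
qed

text \<open>By the mean value theorem a difference quotient of \<open>q\<close> is a value of
  \<open>q'\<close> at a shifted point, and \<open>q'\<close> has a Gaussian majorant on bounded
  sets of points. The derivative never touches \<open>g\<close>.\<close>

lemma DERIV_heat_bounded_integral:
  fixes g :: "real ^ 'n::finite \<Rightarrow> real"
  assumes q: "heat_bounded q" and q': "heat_bounded q'" and e: "norm e \<le> 1"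
    and D: "\<And>z s. ((\<lambda>s. q (z + s *\<^sub>R e)) has_real_derivative q' (z + s *\<^sub>R e)) (at s)"
    and g: "g \<in> borel_measurable lebesgue"
    and b: "\<And>\<eta>. \<bar>g \<eta>\<bar> \<le> K * (1 + norm \<eta> powr m)" and "m \<ge> 0"
  shows "((\<lambda>s. LINT \<eta>|lebesgue. q (\<xi> + s *\<^sub>R e - \<eta>) * g \<eta>) has_real_derivative
           (LINT \<eta>|lebesgue. q' (\<xi> - \<eta>) * g \<eta>)) (at 0)"
proof -
  have "K \<ge> 0" using order_trans[OF abs_ge_zero b[of 0]] by simp
  \<comment> \<open>The intermediate point of the mean value theorem is shifted from
    \<open>\<xi>\<close> by at most 1, as \<open>\<bar>\<tau>\<bar> \<le> 1\<close> and
    \<open>norm e \<le> 1\<close>.\<close>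
  from heat_bounded_gaussian_bound[OF \<open>m \<ge> 0\<close> this, of "norm \<xi> + 1", where 'n = 'n]
  obtain A where A: "\<bar>q' (\<xi>' - \<eta>) * g \<eta>\<bar> \<le> A * exp (- (1 / 32) * (norm \<eta>)\<^sup>2)"
    if "norm \<xi>' \<le> norm \<xi> + 1" for \<xi>' \<eta>
    using b q' by blast
  let ?Q = "\<lambda>\<tau> \<eta>. (q (\<xi> + \<tau> *\<^sub>R e - \<eta>) - q (\<xi> - \<eta>)) / \<tau> * g \<eta>"
  have int: "integrable lebesgue (\<lambda>\<eta>. q (\<xi>' - \<eta>) * g \<eta>)" for \<xi>'
    by (rule integrable_heat_bounded[OF q g b \<open>m \<ge> 0\<close>])
  have bound: "norm (?Q \<tau> \<eta>) \<le> A * exp (- (1 / 32) * (norm \<eta>)\<^sup>2)" if "\<tau> \<noteq> 0" "\<bar>\<tau>\<bar> \<le> 1" for \<tau> \<eta>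
  proof -
    obtain \<theta> where \<theta>: "\<bar>\<theta>\<bar> \<le> 1"
      "q (\<xi> - \<eta> + \<tau> *\<^sub>R e) - q (\<xi> - \<eta> + 0 *\<^sub>R e) = \<tau> * q' (\<xi> - \<eta> + \<theta> *\<^sub>R e)"
    proof (cases "\<tau> > 0")
      case True
      from MVT2[OF this, of "\<lambda>s. q (\<xi> - \<eta> + s *\<^sub>R e)" "\<lambda>s. q' (\<xi> - \<eta> + s *\<^sub>R e)", OF D]
      obtain z where "0 < z" "z < \<tau>"
        "q (\<xi> - \<eta> + \<tau> *\<^sub>R e) - q (\<xi> - \<eta> + 0 *\<^sub>R e) = (\<tau> - 0) * q' (\<xi> - \<eta> + z *\<^sub>R e)" by blast
      with that[of z] \<open>\<bar>\<tau>\<bar> \<le> 1\<close> show ?thesis by auto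
    next
      case False
      with \<open>\<tau> \<noteq> 0\<close> have "\<tau> < 0" by simp
      from MVT2[OF this, of "\<lambda>s. q (\<xi> - \<eta> + s *\<^sub>R e)" "\<lambda>s. q' (\<xi> - \<eta> + s *\<^sub>R e)", OF D]
      obtain z where "\<tau> < z" "z < 0"
        "q (\<xi> - \<eta> + 0 *\<^sub>R e) - q (\<xi> - \<eta> + \<tau> *\<^sub>R e) = (0 - \<tau>) * q' (\<xi> - \<eta> + z *\<^sub>R e)" by blast
      with that[of z] \<open>\<bar>\<tau>\<bar> \<le> 1\<close> show ?thesis by simp
    qed
    have "norm (\<xi> + \<theta> *\<^sub>R e) \<le> norm \<xi> + \<bar>\<theta>\<bar> * norm e"
      by (metis norm_scaleR norm_triangle_ineq)
    also have "\<bar>\<theta>\<bar> * norm e \<le> 1 * 1" using \<theta> e by (intro mult_mono) auto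
    finally have "norm (\<xi> + \<theta> *\<^sub>R e) \<le> norm \<xi> + 1" by simp
    from A[OF this, of \<eta>] \<theta>(2) \<open>\<tau> \<noteq> 0\<close> show ?thesis
      by (simp add: algebra_simps)
  qed
  have "((\<lambda>\<tau>. LINT \<eta>|lebesgue. ?Q \<tau> \<eta>) \<longlongrightarrow> (LINT \<eta>|lebesgue. q' (\<xi> - \<eta>) * g \<eta>)) (at 0)"
    unfolding tendsto_at_iff_sequentially comp_def
  proof (intro allI impI)
    fix X :: "nat \<Rightarrow> real" assume X: "\<forall>i. X i \<in> UNIV - {0}" "X \<longlonglongrightarrow> 0"
    then have "eventually (\<lambda>i. \<bar>X i\<bar> < 1) sequentially"
      using tendsto_rabs_zero_iff[of X sequentially] order_tendstoD(2)[of "\<lambda>i. \<bar>X i\<bar>" 0 sequentially 1] by auto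
    then obtain N where N: "\<And>i. i \<ge> N \<Longrightarrow> \<bar>X i\<bar> < 1" by (auto simp: eventually_sequentially)
    show "(\<lambda>i. LINT \<eta>|lebesgue. ?Q (X i) \<eta>) \<longlonglongrightarrow> (LINT \<eta>|lebesgue. q' (\<xi> - \<eta>) * g \<eta>)"
    \<comment> \<open>The majorant is available only for steps of size at most 1, so an initial
      segment of the sequence is discarded.\<close>
    proof (rule LIMSEQ_offset[where k = N], rule integral_dominated_convergence)
      show "(\<lambda>\<eta>. q' (\<xi> - \<eta>) * g \<eta>) \<in> borel_measurable lebesgue"
        by (intro borel_measurable_times g borel_measurable_heat_bounded q')
      show "(\<lambda>\<eta>. ?Q (X (i + N)) \<eta>) \<in> borel_measurable lebesgue" for i
        by (intro borel_measurable_times borel_measurable_divide borel_measurable_diff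
            g borel_measurable_heat_bounded q borel_measurable_const)
      show "integrable lebesgue (\<lambda>\<eta> :: real ^ 'n. A * exp (- (1 / 32) * (norm \<eta>)\<^sup>2))"
        by (intro integrable_mult_right integrable_gaussian) auto
      show "AE \<eta> in lebesgue. norm (?Q (X (i + N)) \<eta>) \<le> A * exp (- (1 / 32) * (norm \<eta>)\<^sup>2)" for i
        using bound[of "X (i + N)"] X(1) N[of "i + N"] by (intro AE_I2) (simp add: less_imp_le)
      have "(\<lambda>i. (q (\<xi> + X (i + N) *\<^sub>R e - \<eta>) - q (\<xi> - \<eta>)) / X (i + N)) \<longlonglongrightarrow> q' (\<xi> - \<eta>)" for \<eta>
      proof -
        have "((\<lambda>\<tau>. (q (\<xi> - \<eta> + \<tau> *\<^sub>R e) - q (\<xi> - \<eta>)) / \<tau>) \<longlongrightarrow> q' (\<xi> - \<eta>)) (at 0)"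
          using D[of "\<xi> - \<eta>" 0] by (simp add: DERIV_def)
        moreover have "filterlim (\<lambda>i. X (i + N)) (at 0) sequentially"
          using X by (auto simp: filterlim_at intro: LIMSEQ_ignore_initial_segment)
        ultimately have "(\<lambda>i. (q (\<xi> - \<eta> + X (i + N) *\<^sub>R e) - q (\<xi> - \<eta>)) / X (i + N)) \<longlonglongrightarrow> q' (\<xi> - \<eta>)"
          by (rule filterlim_compose)
        then show ?thesis by (simp add: algebra_simps)
      qed
      then show "AE \<eta> in lebesgue. (\<lambda>i. ?Q (X (i + N)) \<eta>) \<longlonglongrightarrow> q' (\<xi> - \<eta>) * g \<eta>"
        by (intro AE_I2 tendsto_mult tendsto_const)
    qed
  qed
  \<comment> \<open>Valid for \<open>\<tau> = 0\<close> as well, where division by zero makes both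
    sides 0; it can therefore be used as an unconditional rewrite under the limit.\<close>
  moreover have eq: "(LINT \<eta>|lebesgue. ?Q \<tau> \<eta>) =
      ((LINT \<eta>|lebesgue. q (\<xi> + \<tau> *\<^sub>R e - \<eta>) * g \<eta>) - (LINT \<eta>|lebesgue. q (\<xi> - \<eta>) * g \<eta>)) / \<tau>" for \<tau>
  proof -
    have "(LINT \<eta>|lebesgue. ?Q \<tau> \<eta>) =
        (LINT \<eta>|lebesgue. (q (\<xi> + \<tau> *\<^sub>R e - \<eta>) * g \<eta> - q (\<xi> - \<eta>) * g \<eta>) / \<tau>)"
      by (intro Bochner_Integration.integral_cong) (auto simp: field_simps)
    then show ?thesis
      by (simp add: Bochner_Integration.integral_diff[OF int int])
  qed
  ultimately show ?thesis
    unfolding DERIV_def eq by simp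
qed

section \<open>The Hessian of the regularization\<close>

lemma heat_kernel_hess_minus: "heat_kernel_hess i j (- z) = heat_kernel_hess i j z"
  by (simp add: heat_kernel_hess_def heat_kernel_minus)

lemma heat_kernel_hess_commute: "heat_kernel_hess i j = heat_kernel_hess j i"
  by (auto simp: heat_kernel_hess_def fun_eq_iff)

lemma heat_kernel_scale:
  assumes "s > 0"
  shows "heat_kernel (s\<^sup>2) (s *\<^sub>R z) = heat_kernel 1 (z :: real ^ 'n::finite) / s ^ CARD('n)"
proof -
  have "(s\<^sup>2) powr (real CARD('n) / 2) = s powr (2 * (real CARD('n) / 2))"
    using assms by (subst powr_powr[symmetric]) simp
  also have "\<dots> = s ^ CARD('n)" using assms by (simp add: powr_realpow)
  finally have "(4 * pi * s\<^sup>2) powr (real CARD('n) / 2) = (4 * pi) powr (real CARD('n) / 2) * s ^ CARD('n)"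
    by (simp add: powr_mult)
  then show ?thesis
    using assms by (simp add: heat_kernel_def power_mult_distrib)
qed

text \<open>Substituting \<open>y = s *\<^sub>R \<eta>\<close> produces the Jacobian
  \<open>s ^ CARD('n)\<close>, which cancels the normalization of the kernel at time
  \<open>s\<^sup>2\<close>.\<close>

lemma heat_reg_scale:
  fixes f :: "real ^ 'n::finite \<Rightarrow> real"
  assumes f: "f \<in> borel_measurable lebesgue" and s: "s > 0"
  shows "heat_reg (s\<^sup>2) f x = heat_reg 1 (\<lambda>\<eta>. f (s *\<^sub>R \<eta>)) ((1 / s) *\<^sub>R x)"
proof -
  have "continuous_on UNIV (\<lambda>y. heat_kernel (s\<^sup>2) (x - y))"
    using s by (intro continuous_intros) auto
  then have "(\<lambda>y. heat_kernel (s\<^sup>2) (x - y) * f y) \<in> borel_measurable lebesgue"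
    by (intro borel_measurable_times f borel_measurable_lebesgue_if_borel borel_measurable_continuous_onI)
  then have "heat_reg (s\<^sup>2) f x =
      s ^ CARD('n) * (LINT \<eta>|lebesgue. heat_kernel (s\<^sup>2) (x - s *\<^sub>R \<eta>) * f (s *\<^sub>R \<eta>))"
    unfolding heat_reg_def using s by (subst lebesgue_integral_affine[where c = s and u = 0]) auto
  also have "\<dots> = (LINT \<eta>|lebesgue. s ^ CARD('n) * (heat_kernel (s\<^sup>2) (s *\<^sub>R ((1 / s) *\<^sub>R x - \<eta>)) * f (s *\<^sub>R \<eta>)))"
    using s by (simp add: scaleR_diff_right)
  also have "\<dots> = heat_reg 1 (\<lambda>\<eta>. f (s *\<^sub>R \<eta>)) ((1 / s) *\<^sub>R x)"
    unfolding heat_reg_def heat_kernel_scale[OF s] using s by simp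
  finally show ?thesis .
qed

text \<open>\<open>partial_deriv\<close> rests on \<open>deriv\<close>, which is informative only
  where a derivative exists; hence the hypothesis in terms of \<open>has_real_derivative\<close>.
  The shape \<open>k * F (c *\<^sub>R x)\<close> is preserved by differentiation, so the rule
  applies to both partial derivatives of the Hessian.\<close>

lemma partial_deriv_scale:
  assumes "((\<lambda>\<tau>. F (c *\<^sub>R x + \<tau> *\<^sub>R axis j 1)) has_real_derivative D) (at 0)"
  shows "partial_deriv j (\<lambda>x. k * F (c *\<^sub>R x)) x = k * c * D"
proof -
  have "((\<lambda>\<tau>. c * \<tau>) has_real_derivative c) (at 0)"
    by (auto intro!: derivative_eq_intros)
  then have "((\<lambda>\<tau>. F (c *\<^sub>R x + (c * \<tau>) *\<^sub>R axis j 1)) has_real_derivative D * c) (at 0)"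
    using assms by (intro DERIV_chain2[where f = "\<lambda>\<tau>. F (c *\<^sub>R x + \<tau> *\<^sub>R axis j 1)" and g = "\<lambda>\<tau>. c * \<tau>"]) auto
  from DERIV_cmult[OF this, of k]
  have "((\<lambda>\<tau>. k * F (c *\<^sub>R (x + \<tau> *\<^sub>R axis j 1))) has_real_derivative k * (D * c)) (at 0)"
    by (simp add: scaleR_add_right)
  then show ?thesis
    unfolding partial_deriv_def by (subst DERIV_imp_deriv) (auto simp: mult_ac)
qed

lemma hessian_heat_reg:
  fixes f :: "real ^ 'n::finite \<Rightarrow> real"
  assumes f: "f \<in> borel_measurable lebesgue" and s: "s > 0"
    and b: "\<And>\<eta>. \<bar>f (s *\<^sub>R \<eta>)\<bar> \<le> K * (1 + norm \<eta> powr m)" and m: "m \<ge> 0"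
  shows "hessian (heat_reg (s\<^sup>2) f) x =
    (\<chi> i j. (LINT \<eta>|lebesgue. heat_kernel_hess i j ((1 / s) *\<^sub>R x - \<eta>) * f (s *\<^sub>R \<eta>)) / s\<^sup>2)"
proof -
  let ?c = "1 / s"
  define g where "g = (\<lambda>\<eta>. f (s *\<^sub>R \<eta>))"
  have g: "g \<in> borel_measurable lebesgue"
    unfolding g_def using lebesgue_measurable_affine[OF f, of s 0] s by simp
  have b: "\<bar>g \<eta>\<bar> \<le> K * (1 + norm \<eta> powr m)" for \<eta> using b by (simp add: g_def)
  define P where "P j \<xi> = (LINT \<eta>|lebesgue. heat_kernel_grad j (\<xi> - \<eta>) * g \<eta>)" for j \<xi>
  define Q where "Q i j \<xi> = (LINT \<eta>|lebesgue. heat_kernel_hess i j (\<xi> - \<eta>) * g \<eta>)" for i j \<xi>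
  have eq: "heat_reg (s\<^sup>2) f = (\<lambda>x. 1 * heat_reg 1 g (?c *\<^sub>R x))"
    using heat_reg_scale[OF f s] by (simp add: g_def fun_eq_iff)
  have "((\<lambda>\<tau>. heat_reg 1 g (\<xi> + \<tau> *\<^sub>R axis j 1)) has_real_derivative P j \<xi>) (at 0)" for j \<xi>
    unfolding heat_reg_def P_def
    by (rule DERIV_heat_bounded_integral[OF heat_bounded_heat_kernel heat_bounded_heat_kernel_grad
          _ DERIV_heat_kernel g b m]) (simp add: norm_axis_1)
  from partial_deriv_scale[OF this, where k = 1]
  have 1: "partial_deriv j (heat_reg (s\<^sup>2) f) = (\<lambda>x. ?c * P j (?c *\<^sub>R x))" for j
    unfolding eq fun_eq_iff by simp
  have "((\<lambda>\<tau>. P j (\<xi> + \<tau> *\<^sub>R axis i 1)) has_real_derivative Q i j \<xi>) (at 0)" for i j \<xi>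
    unfolding P_def Q_def
    by (rule DERIV_heat_bounded_integral[OF heat_bounded_heat_kernel_grad heat_bounded_heat_kernel_hess
          _ DERIV_heat_kernel_grad g b m]) (simp add: norm_axis_1)
  then have "partial_deriv i (partial_deriv j (heat_reg (s\<^sup>2) f)) x = ?c * ?c * Q i j (?c *\<^sub>R x)" for i j
    unfolding 1 by (rule partial_deriv_scale)
  then show ?thesis
    by (simp add: hessian_def Q_def g_def power2_eq_square)
qed

section \<open>Criteria for the sign of an integral and inequalities for convex functions\<close>

lemma integral_pos_if_pos_on_open:
  fixes h :: "real ^ 'n::finite \<Rightarrow> real"
  assumes h: "integrable lebesgue h" and nn: "\<And>y. h y \<ge> 0"
    and S: "open S" "S \<noteq> {}" and pos: "\<And>y. y \<in> S \<Longrightarrow> h y > 0"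
  shows "(LINT y|lebesgue. h y) > 0"
proof (rule ccontr)
  assume "\<not> (LINT y|lebesgue. h y) > 0"
  moreover have "(LINT y|lebesgue. h y) \<ge> 0" using nn by (rule Bochner_Integration.integral_nonneg)
  ultimately have "(LINT y|lebesgue. h y) = 0" by linarith
  then have "AE y in lebesgue. h y = 0"
    using integral_nonneg_eq_0_iff_AE[OF h] nn by simp
  then have "AE y in lebesgue. y \<notin> S"
    by (rule eventually_mono) (use pos in force)
  then have "S \<in> null_sets lebesgue"
    using S(1) by (subst (asm) AE_iff_null_sets[symmetric]) (auto intro: lborelD)
  then show False
    using open_not_negligible[OF S] by (simp add: negligible_iff_null_sets)
qed

text \<open>Translation invariance of the Lebesgue integral makes the gradient of \<open>P\<^sub>1 g\<close> constant along
  axis \<open>i\<close>; no Fubini argument is needed.\<close>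

lemma heat_hess_integral_eq_0_if_invariant:
  fixes g :: "real ^ 'n::finite \<Rightarrow> real"
  assumes g: "g \<in> borel_measurable lebesgue"
    and b: "\<And>\<eta>. \<bar>g \<eta>\<bar> \<le> K * (1 + norm \<eta> powr m)" and m: "m \<ge> 0"
    and inv: "\<And>\<tau> \<eta>. g (\<tau> *\<^sub>R axis i 1 + \<eta>) = g \<eta>"
  shows "(LINT \<eta>|lebesgue. heat_kernel_hess i j (\<xi> - \<eta>) * g \<eta>) = 0"
proof -
  define P where "P \<xi> = (LINT \<eta>|lebesgue. heat_kernel_grad j (\<xi> - \<eta>) * g \<eta>)" for \<xi>
  have "P (\<xi> + \<tau> *\<^sub>R axis i 1) = P \<xi>" for \<tau>
  proof -
    have "(\<lambda>\<eta>. heat_kernel_grad j (\<xi> + \<tau> *\<^sub>R axis i 1 - \<eta>) * g \<eta>) \<in> borel_measurable lebesgue"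
      by (intro borel_measurable_times g borel_measurable_heat_bounded heat_bounded_heat_kernel_grad)
    from lebesgue_integral_affine[OF this, of 1 "\<tau> *\<^sub>R axis i 1"]
    show ?thesis by (simp add: P_def inv)
  qed
  then have "((\<lambda>\<tau>. P (\<xi> + \<tau> *\<^sub>R axis i 1)) has_real_derivative 0) (at 0)"
    by simp
  moreover have "((\<lambda>\<tau>. P (\<xi> + \<tau> *\<^sub>R axis i 1)) has_real_derivative
      (LINT \<eta>|lebesgue. heat_kernel_hess i j (\<xi> - \<eta>) * g \<eta>)) (at 0)"
    unfolding P_def
    by (rule DERIV_heat_bounded_integral[OF heat_bounded_heat_kernel_grad heat_bounded_heat_kernel_hess
          _ DERIV_heat_kernel_grad g b m]) (simp add: norm_axis_1)
  ultimately show ?thesis using DERIV_unique by blast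
qed

text \<open>The absolute value is convex, and the power is increasing and convex for positive
  arguments. A vanishing endpoint is treated by \<open>scale\<close>, which rests on
  \<open>u powr a \<le> u\<close> for \<open>0 < u < 1\<close>.\<close>

lemma convex_on_abs_powr:
  fixes a :: real
  assumes "a \<ge> 1"
  shows "convex_on UNIV (\<lambda>x::real. \<bar>x\<bar> powr a)"
proof (rule convex_onI)
  fix t x y :: real assume t: "0 < t" "t < 1"
  have scale: "(u * X) powr a \<le> u * X powr a" if "0 < u" "u < 1" "X \<ge> 0" for u X :: real
  proof -
    have "u powr a \<le> u powr 1" using that assms by (intro powr_mono') auto
    then show ?thesis using that by (simp add: powr_mult mult_right_mono)
  qed
  have "\<bar>(1 - t) * x + t * y\<bar> \<le> (1 - t) * \<bar>x\<bar> + t * \<bar>y\<bar>"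
    using t abs_triangle_ineq[of "(1 - t) * x" "t * y"] by (simp add: abs_mult)
  then have "\<bar>(1 - t) * x + t * y\<bar> powr a \<le> ((1 - t) * \<bar>x\<bar> + t * \<bar>y\<bar>) powr a"
    using assms by (intro powr_mono2) auto
  also have "\<dots> \<le> (1 - t) * \<bar>x\<bar> powr a + t * \<bar>y\<bar> powr a"
  proof (cases "x = 0 \<or> y = 0")
    case True
    then show ?thesis using scale[of t "\<bar>y\<bar>"] scale[of "1 - t" "\<bar>x\<bar>"] t assms by auto
  next
    case False
    then show ?thesis
      using convex_onD[OF powr_convex[OF assms], of t "\<bar>x\<bar>" "\<bar>y\<bar>"] t by auto
  qed
  finally show "\<bar>(1 - t) *\<^sub>R x + t *\<^sub>R y\<bar> powr a \<le> (1 - t) * \<bar>x\<bar> powr a + t * \<bar>y\<bar> powr a"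
    by simp
qed auto

text \<open>Both \<open>u + w\<close> and \<open>u - w\<close> are convex combinations of
  \<open>u + w'\<close> and \<open>u - w'\<close>, with weights interchanged; adding the two
  convexity inequalities makes the weights sum to 1.\<close>

lemma convex_on_symmetric_sum_mono:
  fixes h :: "real \<Rightarrow> real"
  assumes h: "convex_on UNIV h" and w: "\<bar>w\<bar> \<le> \<bar>w'\<bar>"
  shows "h (u + w) + h (u - w) \<le> h (u + w') + h (u - w')"
proof (cases "w' = 0")
  case True
  then show ?thesis using w by simp
next
  case False
  define t where "t = (w' - w) / (2 * w')"
  have t: "0 \<le> t" "t \<le> 1" using w False by (auto simp: t_def field_simps abs_if split: if_splits)
  have w_eq: "w = (1 - t) * w' - t * w'" using False by (simp add: t_def field_simps)
  have "h (u + w) = h ((1 - t) *\<^sub>R (u + w') + t *\<^sub>R (u - w'))"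
    by (subst w_eq) (simp add: algebra_simps)
  moreover have "h (u - w) = h ((1 - t) *\<^sub>R (u - w') + t *\<^sub>R (u + w'))"
    by (subst w_eq) (simp add: algebra_simps)
  ultimately show ?thesis
    using convex_onD[OF h t, of "u + w'" "u - w'"] convex_onD[OF h t, of "u - w'" "u + w'"]
    by (simp add: algebra_simps)
qed

section \<open>The limit profile\<close>

lemma powr_le_one_plus_powr:
  fixes u :: real
  assumes "0 \<le> u" "0 \<le> a" "a \<le> m"
  shows "u powr a \<le> 1 + u powr m"
proof (cases "u \<le> 1")
  case True
  then have "u powr a \<le> 1" using assms by (intro powr_le1) auto
  then show ?thesis using powr_ge_zero[of u m] by linarith
next
  case False
  then have "u powr a \<le> u powr m" using assms by (intro powr_mono) auto
  then show ?thesis by simp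
qed

lemma abs_component_powr_le:
  fixes y :: "real ^ 'n::finite"
  assumes "0 \<le> a" "a \<le> m"
  shows "\<bar>y $ k\<bar> powr a \<le> 1 + norm y powr m"
proof -
  have "\<bar>y $ k\<bar> powr a \<le> norm y powr a"
    using assms by (intro powr_mono2 component_le_norm_cart) auto
  then show ?thesis using powr_le_one_plus_powr[of "norm y" a m] assms by simp
qed

lemma abs_component_powr_measurable:
  "0 \<le> a \<Longrightarrow> (\<lambda>y :: real ^ 'n::finite. \<bar>u + c * y $ k\<bar> powr a) \<in> borel_measurable lebesgue"
  by (intro borel_measurable_lebesgue_if_borel) measurable

text \<open>The kernel \<open>(y\<^sub>k\<^sup>2/4 - 1/2) G(y)\<close> is even and has integral zero, so \<open>\<bar>\<xi>\<^sub>k + y\<^sub>k\<bar>\<^bsup>a\<^esup>\<close> may be replaced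
  by half of \<open>\<psi>(y\<^sub>k) - \<psi>(sqrt 2)\<close>, with \<open>\<psi>\<close> even and increasing in \<open>\<bar>y\<^sub>k\<bar>\<close>.  This factor changes sign
  exactly where the kernel does.\<close>

lemma heat_hess_integral_power_pos:
  fixes \<xi> :: "real ^ 'n::finite"
  assumes a: "1 \<le> a" "a \<le> 2"
  shows "(LINT \<eta>|lebesgue. heat_kernel_hess k k (\<xi> - \<eta>) * \<bar>\<eta> $ k\<bar> powr a) > 0"
    (is "?I > 0")
proof -
  define u where "u = \<xi> $ k"
  define h where "h = (\<lambda>x::real. \<bar>x\<bar> powr a)"
  define \<psi> where "\<psi> w = h (u + w) + h (u - w)" for w
  let ?q = "\<lambda>y. heat_kernel_hess k k (0 - y)"
  have q: "heat_bounded (heat_kernel_hess k k :: real ^ 'n \<Rightarrow> real)"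
    by (rule heat_bounded_heat_kernel_hess)
  have convex: "convex_on UNIV h" unfolding h_def using a(1) by (rule convex_on_abs_powr)
  have meas: "(\<lambda>y :: real ^ 'n. h (u + c * y $ k)) \<in> borel_measurable lebesgue" for c
    unfolding h_def using a by (intro abs_component_powr_measurable) auto
  have int: "integrable lebesgue (\<lambda>y :: real ^ 'n. ?q y * h (u + c * y $ k))"
    if c: "\<bar>c\<bar> = 1" for c
  proof (rule integrable_heat_bounded[OF q meas, where m = 2 and K = "(1 + \<bar>u\<bar>)\<^sup>2 * 2"])
    fix y :: "real ^ 'n"
    let ?v = "\<bar>u\<bar> + norm y"
    have "\<bar>c * y $ k\<bar> \<le> norm y" using c by (simp add: abs_mult component_le_norm_cart)
    \<comment> \<open>The added 1 keeps the base at least 1, so that the exponent \<open>a\<close>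
      can be raised to 2.\<close>
    then have "\<bar>u + c * y $ k\<bar> \<le> 1 + ?v" by linarith
    then have "h (u + c * y $ k) \<le> (1 + ?v) powr a"
      unfolding h_def using a by (intro powr_mono2) auto
    also have "\<dots> \<le> (1 + ?v) powr 2" using a by (intro powr_mono) auto
    also have "\<dots> \<le> ((1 + \<bar>u\<bar>) * (1 + norm y)) powr 2"
      by (intro powr_mono2) (auto simp: algebra_simps)
    also have "\<dots> = (1 + \<bar>u\<bar>)\<^sup>2 * (1 + norm y)\<^sup>2"
      by (simp add: power_mult_distrib)
    also have "(1 + norm y)\<^sup>2 \<le> 2 * (1 + (norm y)\<^sup>2)"
      using zero_le_power2[of "1 - norm y"] by (simp add: power2_eq_square algebra_simps)
    finally show "\<bar>h (u + c * y $ k)\<bar> \<le> (1 + \<bar>u\<bar>)\<^sup>2 * 2 * (1 + norm y powr 2)"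
      by (simp add: h_def mult_left_mono mult.assoc)
  qed simp
  have meas0: "(\<lambda>\<eta>. heat_kernel_hess k k (\<xi> - \<eta>) * \<bar>\<eta> $ k\<bar> powr a) \<in> borel_measurable lebesgue"
    using a abs_component_powr_measurable[of a 0 1 k]
    by (intro borel_measurable_times borel_measurable_heat_bounded heat_bounded_heat_kernel_hess) auto
  \<comment> \<open>Centering at \<open>\<xi>\<close> with either orientation gives the same
    integral because the kernel is even. Adding the two orientations symmetrizes \<open>h\<close>
    into \<open>\<psi>\<close>.\<close>
  have I: "?I = (LINT y|lebesgue. ?q y * h (u + c * y $ k))" if c: "c = 1 \<or> c = - 1" for c
    using c lebesgue_integral_affine[OF meas0, of c \<xi>] heat_kernel_hess_minus[of k k]
    by (auto simp: u_def h_def)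
  have int1: "integrable lebesgue (\<lambda>y :: real ^ 'n. ?q y * 1)"
    by (rule integrable_heat_bounded[OF q, where K = 1 and m = 0]) auto
  \<comment> \<open>A constant function is invariant along axis \<open>k\<close>.\<close>
  have zero: "(LINT y|lebesgue. ?q y * 1) = 0"
    by (rule heat_hess_integral_eq_0_if_invariant[where K = 1 and m = 0]) auto
  let ?H = "\<lambda>y. ?q y * (\<psi> (y $ k) - \<psi> (sqrt 2))"
  have H_eq: "?H y = ?q y * h (u + 1 * y $ k) + ?q y * h (u + (- 1) * y $ k) - \<psi> (sqrt 2) * (?q y * 1)" for y
    by (simp add: \<psi>_def algebra_simps)
  have int_add: "integrable lebesgue (\<lambda>y. ?q y * h (u + 1 * y $ k) + ?q y * h (u + (- 1) * y $ k))"
    by (intro Bochner_Integration.integrable_add int) auto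
  have int_1: "integrable lebesgue (\<lambda>y :: real ^ 'n. \<psi> (sqrt 2) * (?q y * 1))"
    by (intro integrable_mult_right int1)
  have intH: "integrable lebesgue ?H"
    unfolding H_eq by (rule Bochner_Integration.integrable_diff[OF int_add int_1])
  have "(LINT y|lebesgue. ?H y) = ?I + ?I - \<psi> (sqrt 2) * 0"
  proof -
    have "(LINT y|lebesgue. ?q y * h (u + 1 * y $ k) + ?q y * h (u + (- 1) * y $ k)) = ?I + ?I"
      using I[of 1] I[of "- 1"] by (subst Bochner_Integration.integral_add[OF int int]) auto
    moreover have "(LINT y|lebesgue. \<psi> (sqrt 2) * (?q y * 1)) = \<psi> (sqrt 2) * 0"
      using zero by (subst integral_mult_right_zero) simp
    ultimately show ?thesis
      unfolding H_eq by (subst Bochner_Integration.integral_diff[OF int_add int_1]) simp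
  qed
  moreover have "(LINT y|lebesgue. ?H y) > 0"
  proof (rule integral_pos_if_pos_on_open[OF intH])
    have sgn: "(y\<^sup>2 / 4 - 1 / 2) * (\<psi> y - \<psi> (sqrt 2)) \<ge> 0" for y :: real
    proof (cases "\<bar>y\<bar> \<le> \<bar>sqrt 2\<bar>")
      case True
      then have "\<psi> y \<le> \<psi> (sqrt 2)" unfolding \<psi>_def by (rule convex_on_symmetric_sum_mono[OF convex])
      moreover have "y\<^sup>2 \<le> 2" using power_mono[OF True, of 2] by simp
      ultimately show ?thesis by (intro mult_nonpos_nonpos) auto
    next
      case False
      then have "\<psi> (sqrt 2) \<le> \<psi> y" unfolding \<psi>_def by (intro convex_on_symmetric_sum_mono[OF convex]) auto
      moreover have "y\<^sup>2 \<ge> 2" using power_mono[of "\<bar>sqrt 2\<bar>" "\<bar>y\<bar>" 2] False by simp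
      ultimately show ?thesis by (intro mult_nonneg_nonneg) auto
    qed
    have q_eq: "?q y = ((y $ k)\<^sup>2 / 4 - 1 / 2) * heat_kernel 1 y" for y :: "real ^ 'n"
      by (simp add: heat_kernel_hess_def heat_kernel_minus power2_eq_square)
    show "?H y \<ge> 0" for y
      using mult_nonneg_nonneg[OF sgn[of "y $ k"] less_imp_le[OF heat_kernel_pos[of 1 y]]]
      unfolding q_eq by (simp add: mult_ac)
    \<comment> \<open>Strict positivity comes from far out, where no strict convexity of
      \<open>h\<close> is required and \<open>a = 1\<close> is included. The 2 ensures
      \<open>(y $ k)\<^sup>2 > 2\<close> and that raising the exponent from 1 to \<open>a\<close>
      increases the power; the other summand makes \<open>2 * y $ k\<close>, a lower bound for
      \<open>\<psi> (y $ k)\<close>, exceed \<open>\<psi> (sqrt 2)\<close>.\<close>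
    define M where "M = 2 + \<bar>\<psi> (sqrt 2)\<bar>"
    let ?S = "{y :: real ^ 'n. y $ k > M}"
    show "open ?S" by (intro open_Collect_less continuous_intros)
    have "(\<chi> i. M + 1) \<in> ?S" by simp
    then show "?S \<noteq> {}" by blast
    fix y assume "y \<in> ?S"
    then have y: "y $ k > M" by simp
    have "y $ k = \<bar>y $ k\<bar> powr 1" using y by (simp add: M_def)
    also have "\<dots> \<le> h (y $ k)" unfolding h_def using y a by (intro powr_mono) (auto simp: M_def)
    also have "2 * h (y $ k) \<le> \<psi> (y $ k)"
    proof -
      \<comment> \<open>The roles of center and displacement are exchanged here; this is legitimate
        because \<open>h\<close> is even.\<close>
      have "h (y $ k) + h (y $ k) \<le> h (y $ k + u) + h (y $ k - u)"
        using convex_on_symmetric_sum_mono[OF convex, of 0 u "y $ k"] by simp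
      also have "\<dots> = \<psi> (y $ k)"
        by (simp add: \<psi>_def h_def add.commute abs_minus_commute)
      finally show ?thesis by simp
    qed
    finally have "\<psi> (y $ k) > \<psi> (sqrt 2)" using y unfolding M_def by linarith
    moreover have "(y $ k)\<^sup>2 > 2"
    proof -
      have "2 * 2 \<le> y $ k * y $ k" using y by (intro mult_mono) (auto simp: M_def)
      then show ?thesis by (simp add: power2_eq_square)
    qed
    ultimately show "?H y > 0"
      unfolding q_eq using heat_kernel_pos[of 1 y] by (intro mult_pos_pos) auto
  qed
  ultimately show ?thesis by simp
qed

lemma heat_hess_integral_Phi:
  fixes \<xi> :: "real ^ 'n::finite"
  assumes a: "1 \<le> a" "a \<le> 2"
  shows "(LINT \<eta>|lebesgue. heat_kernel_hess i j (\<xi> - \<eta>) * Phi a \<eta>) =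
    (if i = j then LINT \<eta>|lebesgue. heat_kernel_hess i i (\<xi> - \<eta>) * \<bar>\<eta> $ i\<bar> powr a else 0)"
proof -
  let ?J = "\<lambda>i j k. LINT \<eta>|lebesgue. heat_kernel_hess i j (\<xi> - \<eta>) * \<bar>\<eta> $ k\<bar> powr a"
  have meas: "(\<lambda>\<eta> :: real ^ 'n. \<bar>\<eta> $ k\<bar> powr a) \<in> borel_measurable lebesgue" for k
    using a abs_component_powr_measurable[of a 0 1 k] by simp
  have b: "\<bar>\<bar>\<eta> $ k\<bar> powr a\<bar> \<le> 1 * (1 + norm \<eta> powr 2)" for k and \<eta> :: "real ^ 'n"
    using abs_component_powr_le[of a 2 \<eta> k] a by simp
  have zero: "?J i j k = 0" if "i \<noteq> k" for i j k
    by (rule heat_hess_integral_eq_0_if_invariant[OF meas b]) (use that in \<open>auto simp: axis_def\<close>)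
  have "(LINT \<eta>|lebesgue. heat_kernel_hess i j (\<xi> - \<eta>) * Phi a \<eta>) = (\<Sum>k\<in>UNIV. ?J i j k)"
    unfolding Phi_def sum_distrib_left
    by (rule Bochner_Integration.integral_sum)
       (rule integrable_heat_bounded[OF heat_bounded_heat_kernel_hess meas b], simp)
  also have "\<dots> = (\<Sum>k\<in>UNIV. if k = i then ?J i j i else 0)"
    by (intro sum.cong) (auto simp: zero)
  also have "\<dots> = ?J i j i" by simp
  \<comment> \<open>For \<open>i \<noteq> j\<close> the remaining term depends on coordinate
    \<open>i\<close> only and is killed by the derivative along axis \<open>j\<close>, after
    exchanging the indices of the symmetric kernel.\<close>
  also have "\<dots> = (if i = j then ?J i i i else 0)"
    using zero[of j i i] heat_kernel_hess_commute[of i j] by auto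
  finally show ?thesis .
qed

text \<open>The last bound uses \<open>a \<ge> 1\<close>: each coordinate satisfies
  \<open>\<bar>u\<bar> - 1 \<le> \<bar>u\<bar> powr a\<close>, and the sum of the absolute values
  dominates the Euclidean norm. The loss of 1 per coordinate gives \<open>CARD('n)\<close>.\<close>

lemma Phi_bounds:
  fixes y :: "real ^ 'n::finite"
  assumes a: "1 \<le> a" "a \<le> m"
  shows "0 \<le> Phi a y" "Phi a y \<le> real CARD('n) * (1 + norm y powr m)" "norm y - real CARD('n) \<le> Phi a y"
proof -
  show "0 \<le> Phi a y" unfolding Phi_def by (intro sum_nonneg) auto
  show "Phi a y \<le> real CARD('n) * (1 + norm y powr m)"
    unfolding Phi_def using a by (intro sum_bounded_above[of UNIV, simplified] abs_component_powr_le) auto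
  have "\<bar>y $ i\<bar> - 1 \<le> \<bar>y $ i\<bar> powr a" for i
    using powr_le_one_plus_powr[of "\<bar>y $ i\<bar>" 1 a] a by simp
  then have "(\<Sum>i\<in>UNIV. \<bar>y $ i\<bar> - 1) \<le> Phi a y" unfolding Phi_def by (rule sum_mono)
  then show "norm y - real CARD('n) \<le> Phi a y"
    using norm_le_l1_cart[of y] by (simp add: sum_subtractf)
qed

lemma Phi_measurable: "0 \<le> a \<Longrightarrow> Phi a \<in> borel_measurable lebesgue"
  unfolding Phi_def using abs_component_powr_measurable[of a 0 1]
  by (intro borel_measurable_sum) simp

lemma Phi_scale: "s > 0 \<Longrightarrow> Phi a (s *\<^sub>R y) = s powr a * Phi a y"
  by (simp add: Phi_def abs_mult powr_mult sum_distrib_left)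

section \<open>The rescaled functions\<close>

definition rescale :: "real \<Rightarrow> (real ^ 'n::finite \<Rightarrow> real) \<Rightarrow> real \<Rightarrow> real ^ 'n \<Rightarrow> real" where
  "rescale a f s y = f (s *\<^sub>R y) / s powr a"

text \<open>The local profile as a relative error: used with \<open>\<epsilon> = 1\<close> for
  growth, with 1/2 for the lower bound and with small \<open>\<epsilon>\<close> for the limit. The
  one-sided limit of \<open>\<omega>\<close> leaves out the origin, where \<open>f\<close> and
  \<open>Phi a\<close> both vanish.\<close>

lemma local_profile_near_0:
  fixes f :: "real ^ 'n::finite \<Rightarrow> real"
  assumes "quadratic_lower_bound f" "local_profile a f" "\<epsilon> > 0"
  shows "\<exists>\<delta>>0. \<forall>y. norm y < \<delta> \<longrightarrow> \<bar>f y - Phi a y\<bar> \<le> \<epsilon> * Phi a y"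
proof -
  obtain r0 r \<omega> where r0: "r0 > 0" and \<omega>: "(\<omega> \<longlongrightarrow> 0) (at_right 0)"
    and f: "\<And>x. x \<in> ball 0 r0 \<Longrightarrow> f x = Phi a x + r x \<and> \<bar>r x\<bar> \<le> \<omega> (norm x) * Phi a x"
    and a: "1 \<le> a" "a \<le> 2"
    using assms(2) unfolding local_profile_def by blast
  have "eventually (\<lambda>\<rho>. \<omega> \<rho> < \<epsilon>) (at_right 0)"
    using \<omega> assms(3) by (rule order_tendstoD)
  then obtain d where d: "d > 0" "\<And>\<rho>. 0 < \<rho> \<Longrightarrow> \<rho> < d \<Longrightarrow> \<omega> \<rho> < \<epsilon>"
    by (auto simp: eventually_at_right_field)
  have "\<bar>f y - Phi a y\<bar> \<le> \<epsilon> * Phi a y" if y: "norm y < min r0 d" for y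
  proof (cases "y = 0")
    case True
    then show ?thesis using assms(1) by (simp add: quadratic_lower_bound_def Phi_def)
  next
    case False
    have "\<bar>r y\<bar> \<le> \<omega> (norm y) * Phi a y" "f y = Phi a y + r y" using f[of y] y by auto
    moreover have "\<omega> (norm y) * Phi a y \<le> \<epsilon> * Phi a y"
      using d(2)[of "norm y"] False y Phi_bounds(1)[of a 2 y] a by (intro mult_right_mono) auto
    ultimately show ?thesis by linarith
  qed
  then show ?thesis using r0 d(1) by (intro exI[of _ "min r0 d"]) auto
qed

text \<open>Within distance \<open>\<delta>\<close> of the origin \<open>f \<le> 2 * Phi a\<close>,
  which scales exactly. Farther out the constant 1 in the tail bound is absorbed into
  \<open>norm (s *\<^sub>R y) powr m\<close>, and \<open>s powr m \<le> s powr a\<close> because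
  \<open>s \<le> 1\<close> and \<open>a \<le> m\<close>. \<open>K\<close> adds up the constants of
  both regions.\<close>

lemma rescale_growth:
  fixes f :: "real ^ 'n::finite \<Rightarrow> real"
  assumes lb: "quadratic_lower_bound f" and lp: "local_profile a f" and pt: "polynomial_tail f"
  shows "\<exists>K m. 2 \<le> m \<and>
    (\<forall>s y. 0 < s \<longrightarrow> s \<le> 1 \<longrightarrow> \<bar>rescale a f s y\<bar> \<le> K * (1 + norm y powr m))"
proof -
  have a: "1 \<le> a" "a \<le> 2" using lp by (auto simp: local_profile_def)
  obtain C m where C: "C > 0" "m \<ge> 2" "\<And>x. f x \<le> C * (1 + norm x powr m)"
    using pt unfolding polynomial_tail_def by blast
  obtain \<delta> where \<delta>: "\<delta> > 0" "\<And>y. norm y < \<delta> \<Longrightarrow> \<bar>f y - Phi a y\<bar> \<le> 1 * Phi a y"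
    using local_profile_near_0[OF lb lp, of 1] by auto
  obtain c where c: "c > 0" "\<And>x. f x \<ge> c * (norm x)\<^sup>2"
    using lb unfolding quadratic_lower_bound_def by blast
  have f_nonneg: "f x \<ge> 0" for x
    using c(2)[of x] c(1) zero_le_power2[of "norm x"] by (meson mult_nonneg_nonneg less_imp_le order_trans)
  define K where "K = 2 * real CARD('n) + C * (1 / \<delta> powr m + 1)"
  have K1: "2 * real CARD('n) \<le> K" and K2: "C * (1 / \<delta> powr m + 1) \<le> K"
    using C(1) by (auto simp: K_def)
  have Phi_le: "Phi a y \<le> real CARD('n) * (1 + norm y powr m)" for y :: "real ^ 'n"
    using Phi_bounds(2)[of a m y] a C(2) by simp
  have *: "real CARD('n) * (1 + norm y powr m) \<le> K / 2 * (1 + norm y powr m)" for y :: "real ^ 'n"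
    using K1 by (intro mult_right_mono) (auto simp: add_nonneg_nonneg)
  have "\<bar>rescale a f s y\<bar> \<le> K * (1 + norm y powr m)" if s: "0 < s" "s \<le> 1" for s y
  proof -
    have sa: "s powr a > 0" using s by simp
    have "f (s *\<^sub>R y) \<le> (K * (1 + norm y powr m)) * s powr a"
    proof (cases "norm (s *\<^sub>R y) < \<delta>")
      case True
      then have "f (s *\<^sub>R y) \<le> 2 * Phi a (s *\<^sub>R y)" using \<delta>(2)[of "s *\<^sub>R y"] by simp
      also have "\<dots> = 2 * Phi a y * s powr a" using s by (simp add: Phi_scale)
      also have "\<dots> \<le> (K * (1 + norm y powr m)) * s powr a"
        using Phi_le[of y] *[of y] by (intro mult_right_mono) auto
      finally show ?thesis .
    next
      case False
      let ?N = "norm (s *\<^sub>R y) powr m"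
      have "\<delta> powr m \<le> ?N" using False \<delta>(1) C(2) by (intro powr_mono2) auto
      then have "1 \<le> 1 / \<delta> powr m * ?N" using \<delta>(1) by (simp add: field_simps)
      then have "1 + ?N \<le> (1 / \<delta> powr m + 1) * ?N" by (simp add: distrib_right)
      then have "C * (1 + ?N) \<le> C * ((1 / \<delta> powr m + 1) * ?N)" using C(1) by (intro mult_left_mono) auto
      then have "f (s *\<^sub>R y) \<le> C * (1 / \<delta> powr m + 1) * ?N" using C(3)[of "s *\<^sub>R y"] by (simp add: mult.assoc)
      also have "\<dots> \<le> K * ?N" using K2 by (intro mult_right_mono) auto
      also have "?N = norm y powr m * s powr m" using s by (simp add: powr_mult mult.commute)
      also have "K * (norm y powr m * s powr m) \<le> K * ((1 + norm y powr m) * s powr a)"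
      proof -
        have "s powr m \<le> s powr a" using s a C(2) by (intro powr_mono') auto
        then show ?thesis
          using K1 by (intro mult_left_mono mult_mono) (auto intro: order_trans[OF _ K1])
      qed
      finally show ?thesis by (simp add: mult.assoc)
    qed
    then show ?thesis
      using sa f_nonneg[of "s *\<^sub>R y"] by (simp add: rescale_def divide_le_eq)
  qed
  then show ?thesis using C(2) by blast
qed

text \<open>Near the origin half of \<open>Phi a\<close> remains, and it grows linearly up to the
  constant \<open>CARD('n)\<close>. Away from it one of the two factors in
  \<open>c * (norm (s *\<^sub>R y))\<^sup>2\<close> is at least \<open>\<delta>\<close>, and the
  other supplies a factor \<open>s\<close>, which is at least \<open>s powr a\<close>.\<close>

lemma rescale_lower_bound:
  fixes f :: "real ^ 'n::finite \<Rightarrow> real"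
  assumes lb: "quadratic_lower_bound f" and lp: "local_profile a f"
  shows "\<exists>k>0. \<forall>s y. 0 < s \<longrightarrow> s \<le> 1 \<longrightarrow> k * (norm y - real CARD('n)) \<le> rescale a f s y"
proof -
  have a: "1 \<le> a" "a \<le> 2" using lp by (auto simp: local_profile_def)
  obtain \<delta> where \<delta>: "\<delta> > 0" "\<And>y. norm y < \<delta> \<Longrightarrow> \<bar>f y - Phi a y\<bar> \<le> 1 / 2 * Phi a y"
    using local_profile_near_0[OF lb lp, of "1 / 2"] by auto
  obtain c where c: "c > 0" "\<And>x. f x \<ge> c * (norm x)\<^sup>2"
    using lb unfolding quadratic_lower_bound_def by blast
  define k where "k = min (1 / 2) (c * \<delta>)"
  have k: "k > 0" "k \<le> 1 / 2" "k \<le> c * \<delta>" using c(1) \<delta>(1) by (auto simp: k_def)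
  have "k * (norm y - real CARD('n)) \<le> rescale a f s y" if s: "0 < s" "s \<le> 1" for s y
  proof -
    have sa: "s powr a > 0" using s by simp
    have "k * (norm y - real CARD('n)) * s powr a \<le> f (s *\<^sub>R y)"
    proof (cases "norm (s *\<^sub>R y) < \<delta>")
      case True
      have P: "norm y - real CARD('n) \<le> Phi a y" "0 \<le> Phi a y" using Phi_bounds[of a 2 y] a by auto
      have "k * (norm y - real CARD('n)) \<le> k * Phi a y"
        using P k by (intro mult_left_mono) auto
      also have "\<dots> \<le> 1 / 2 * Phi a y" using P k by (intro mult_right_mono) auto
      finally have "k * (norm y - real CARD('n)) * s powr a \<le> 1 / 2 * Phi a y * s powr a"
        by (rule mult_right_mono) simp
      also have "\<dots> = 1 / 2 * Phi a (s *\<^sub>R y)" using s by (simp add: Phi_scale)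
      also have "\<dots> \<le> f (s *\<^sub>R y)" using \<delta>(2)[OF True] by linarith
      finally show ?thesis .
    next
      case False
      have "k * (norm y - real CARD('n)) * s powr a \<le> k * norm y * s powr a"
        using k by (intro mult_right_mono mult_left_mono) auto
      also have "\<dots> \<le> c * \<delta> * norm y * s powr 1"
        using k c(1) \<delta>(1) s a by (intro mult_mono powr_mono') auto
      also have "\<dots> = c * (\<delta> * norm (s *\<^sub>R y))" using s by simp
      also have "\<dots> \<le> c * (norm (s *\<^sub>R y) * norm (s *\<^sub>R y))"
        using False c(1) by (intro mult_left_mono mult_right_mono) auto
      also have "\<dots> \<le> f (s *\<^sub>R y)" using c(2)[of "s *\<^sub>R y"] by (simp add: power2_eq_square)
      finally show ?thesis .
    qed
    then show ?thesis using sa by (simp add: rescale_def pos_le_divide_eq)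
  qed
  then show ?thesis using k(1) by blast
qed

text \<open>\<open>Phi a\<close> is homogeneous of degree \<open>a\<close>, so a relative error near
  the origin survives the rescaling unchanged.\<close>

lemma rescale_tendsto_Phi:
  fixes f :: "real ^ 'n::finite \<Rightarrow> real"
  assumes lb: "quadratic_lower_bound f" and lp: "local_profile a f"
    and S: "S \<longlonglongrightarrow> 0" "\<And>k. S k > 0"
  shows "(\<lambda>k. rescale a f (S k) y) \<longlonglongrightarrow> Phi a y"
proof (rule LIMSEQ_I)
  fix r :: real assume r: "r > 0"
  have a: "1 \<le> a" "a \<le> 2" using lp by (auto simp: local_profile_def)
  have P: "0 \<le> Phi a y" using Phi_bounds[of a 2 y] a by auto
  \<comment> \<open>The 1 in the denominator covers points where \<open>Phi a y = 0\<close>.\<close>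
  define \<epsilon> where "\<epsilon> = r / (Phi a y + 1)"
  have \<epsilon>: "\<epsilon> > 0" "\<epsilon> * Phi a y < r" using r P by (auto simp: \<epsilon>_def field_simps)
  obtain \<delta> where \<delta>: "\<delta> > 0" "\<And>y. norm y < \<delta> \<Longrightarrow> \<bar>f y - Phi a y\<bar> \<le> \<epsilon> * Phi a y"
    using local_profile_near_0[OF lb lp \<epsilon>(1)] by auto
  have "(\<lambda>k. norm (S k *\<^sub>R y)) \<longlonglongrightarrow> norm (0 *\<^sub>R y)"
    by (intro tendsto_intros S(1))
  then have "eventually (\<lambda>k. norm (S k *\<^sub>R y) < \<delta>) sequentially"
    using \<delta>(1) by (intro order_tendstoD(2)) auto
  then obtain N where N: "\<And>k. k \<ge> N \<Longrightarrow> norm (S k *\<^sub>R y) < \<delta>"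
    by (auto simp: eventually_sequentially)
  have "norm (rescale a f (S k) y - Phi a y) < r" if "k \<ge> N" for k
  proof -
    have sa: "S k powr a > 0" using S(2)[of k] by simp
    have "\<bar>f (S k *\<^sub>R y) - S k powr a * Phi a y\<bar> \<le> \<epsilon> * (S k powr a * Phi a y)"
      using \<delta>(2)[OF N[OF that]] by (simp add: Phi_scale S(2))
    moreover have "rescale a f (S k) y - Phi a y = (f (S k *\<^sub>R y) - S k powr a * Phi a y) / S k powr a"
      using sa by (simp add: rescale_def field_simps)
    ultimately have "\<bar>rescale a f (S k) y - Phi a y\<bar> \<le> \<epsilon> * Phi a y"
      using sa by (simp add: abs_divide divide_le_eq mult_ac)
    then show ?thesis using \<epsilon>(2) by simp
  qed
  then show "\<exists>N. \<forall>k\<ge>N. norm (rescale a f (S k) y - Phi a y) < r" by blast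
qed

lemma rescale_measurable:
  fixes f :: "real ^ 'n::finite \<Rightarrow> real"
  assumes "f \<in> borel_measurable lebesgue" "s > 0"
  shows "rescale a f s \<in> borel_measurable lebesgue"
  unfolding rescale_def using lebesgue_measurable_affine[OF assms(1), of s 0] assms(2)
  by (intro borel_measurable_divide) auto

text \<open>Insert \<open>norm \<eta> \<ge> norm \<xi> - norm (\<xi> - \<eta>)\<close> into the
  lower bound for \<open>g\<close> and integrate against the kernel: its mass
  \<open>\<gamma>0\<close> yields the slope, its first absolute moment \<open>\<gamma>1\<close>
  enters the offset. Both constants precede \<open>g\<close>, hence hold for all rescaled functions
  at once.\<close>

lemma heat_reg_coercive:
  fixes k b :: real
  assumes "k > 0"
  shows "\<exists>\<gamma> \<beta>. \<gamma> > 0 \<and> (\<forall>g (\<xi> :: real ^ 'n::finite) K m. g \<in> borel_measurable lebesgue \<longrightarrow> m \<ge> 0 \<longrightarrow>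
    (\<forall>y. \<bar>g y\<bar> \<le> K * (1 + norm y powr m)) \<longrightarrow> (\<forall>y. k * (norm y - b) \<le> g y) \<longrightarrow>
    \<gamma> * norm \<xi> - \<beta> \<le> heat_reg 1 g \<xi>)"
proof -
  let ?G = "heat_kernel 1 :: real ^ 'n \<Rightarrow> real"
  define \<gamma>0 where "\<gamma>0 = (LINT y|lebesgue. ?G y)"
  define \<gamma>1 where "\<gamma>1 = (LINT y|lebesgue. ?G y * norm y)"
  have reflect: "(LINT \<eta>|lebesgue. h (\<xi> - \<eta>)) = (LINT y|lebesgue. h y)"
    if "continuous_on UNIV h" for h :: "real ^ 'n \<Rightarrow> real" and \<xi>
    using lebesgue_integral_affine[of h "- 1" \<xi>] borel_measurable_continuous_onI[OF that]
    by (simp add: borel_measurable_lebesgue_if_borel)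
  have int1: "integrable lebesgue (\<lambda>\<eta>. ?G (\<xi> - \<eta>) * 1)" for \<xi>
    by (rule integrable_heat_bounded[OF heat_bounded_heat_kernel, where K = 1 and m = 0]) auto
  have int2: "integrable lebesgue (\<lambda>\<eta>. ?G (\<xi> - \<eta>) * norm (\<xi> - \<eta>))" for \<xi>
  proof (rule integrable_heat_bounded[OF heat_bounded_heat_kernel, where K = "1 + norm \<xi>" and m = 1])
    show "(\<lambda>\<eta>. norm (\<xi> - \<eta>)) \<in> borel_measurable lebesgue"
      by (intro borel_measurable_lebesgue_if_borel) measurable
    fix \<eta>
    have "norm (\<xi> - \<eta>) \<le> norm \<xi> + norm \<eta>" by (rule norm_triangle_ineq4)
    also have "\<dots> \<le> (1 + norm \<xi>) * (1 + norm \<eta>)" by (simp add: algebra_simps)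
    finally show "\<bar>norm (\<xi> - \<eta>)\<bar> \<le> (1 + norm \<xi>) * (1 + norm \<eta> powr 1)" by simp
  qed simp
  have "integrable lebesgue ?G"
    using int1[of 0] by (simp add: heat_kernel_minus)
  then have "\<gamma>0 > 0"
    unfolding \<gamma>0_def by (rule integral_pos_if_pos_on_open[where S = UNIV]) (auto simp: heat_kernel_pos less_imp_le)
  have "k * \<gamma>0 * norm \<xi> - k * (b * \<gamma>0 + \<gamma>1) \<le> heat_reg 1 g \<xi>"
    if g: "g \<in> borel_measurable lebesgue" and m: "m \<ge> 0"
      and gb: "\<And>y. \<bar>g y\<bar> \<le> K * (1 + norm y powr m)" and gk: "\<And>y. k * (norm y - b) \<le> g y"
    for g K m and \<xi> :: "real ^ 'n"
  proof -
    let ?h = "\<lambda>\<eta>. k * (norm \<xi> - b) * (?G (\<xi> - \<eta>) * 1) - k * (?G (\<xi> - \<eta>) * norm (\<xi> - \<eta>))"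
    have "(LINT \<eta>|lebesgue. ?h \<eta>) \<le> (LINT \<eta>|lebesgue. ?G (\<xi> - \<eta>) * g \<eta>)"
    proof (rule integral_mono)
      show "integrable lebesgue ?h"
        by (intro Bochner_Integration.integrable_diff integrable_mult_right int1 int2)
      show "integrable lebesgue (\<lambda>\<eta>. ?G (\<xi> - \<eta>) * g \<eta>)"
        by (rule integrable_heat_bounded[OF heat_bounded_heat_kernel g gb m])
      fix \<eta>
      have "norm \<xi> - norm (\<xi> - \<eta>) \<le> norm \<eta>"
        using norm_triangle_ineq2[of \<xi> "\<xi> - \<eta>"] by simp
      then have "k * (norm \<xi> - norm (\<xi> - \<eta>) - b) \<le> k * (norm \<eta> - b)"
        using assms by (intro mult_left_mono) auto
      also have "\<dots> \<le> g \<eta>" by (rule gk)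
      finally have "?G (\<xi> - \<eta>) * (k * (norm \<xi> - norm (\<xi> - \<eta>) - b)) \<le> ?G (\<xi> - \<eta>) * g \<eta>"
        by (rule mult_left_mono) (simp add: heat_kernel_pos less_imp_le)
      then show "?h \<eta> \<le> ?G (\<xi> - \<eta>) * g \<eta>" by (simp add: algebra_simps)
    qed
    moreover have "(LINT \<eta>|lebesgue. ?h \<eta>) = k * (norm \<xi> - b) * \<gamma>0 - k * \<gamma>1"
    proof -
      have "(LINT \<eta>|lebesgue. ?h \<eta>) = k * (norm \<xi> - b) * (LINT \<eta>|lebesgue. ?G (\<xi> - \<eta>) * 1)
          - k * (LINT \<eta>|lebesgue. ?G (\<xi> - \<eta>) * norm (\<xi> - \<eta>))"
        by (subst Bochner_Integration.integral_diff[OF integrable_mult_right integrable_mult_right, OF int1 int2])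
          (simp only: integral_mult_right_zero)
      also have "(LINT \<eta>|lebesgue. ?G (\<xi> - \<eta>) * 1) = \<gamma>0"
        using reflect[of ?G \<xi>] by (simp add: \<gamma>0_def continuous_on_heat_kernel)
      also have "(LINT \<eta>|lebesgue. ?G (\<xi> - \<eta>) * norm (\<xi> - \<eta>)) = \<gamma>1"
        unfolding \<gamma>1_def
        by (rule reflect[of "\<lambda>y. ?G y * norm y"]) (intro continuous_intros zero_less_one)
      finally show ?thesis .
    qed
    ultimately show ?thesis by (simp add: heat_reg_def algebra_simps)
  qed
  then show ?thesis
    using \<open>\<gamma>0 > 0\<close> assms by (intro exI[of _ "k * \<gamma>0"] exI[of _ "k * (b * \<gamma>0 + \<gamma>1)"]) auto
qed

section \<open>Positive definiteness\<close>

text \<open>The Hessian of \<open>heat_reg 1 g\<close> with both derivatives on the kernel; in this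
  form it passes to the limit in \<open>g\<close>.\<close>

definition heat_hess :: "(real ^ 'n::finite \<Rightarrow> real) \<Rightarrow> real ^ 'n \<Rightarrow> real ^ 'n ^ 'n" where
  "heat_hess g \<xi> = (\<chi> i j. LINT \<eta>|lebesgue. heat_kernel_hess i j (\<xi> - \<eta>) * g \<eta>)"

lemma inner_matrix_vector_mult_eq_sum:
  fixes A :: "real ^ 'n::finite ^ 'n"
  shows "v \<bullet> (A *v v) = (\<Sum>i\<in>UNIV. \<Sum>j\<in>UNIV. v $ i * A $ i $ j * v $ j)"
  by (simp add: inner_vec_def matrix_vector_mult_def sum_distrib_left mult.assoc)

lemma heat_hess_Phi_pos:
  fixes v :: "real ^ 'n::finite"
  assumes "1 \<le> a" "a \<le> 2" "v \<noteq> 0"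
  shows "v \<bullet> (heat_hess (Phi a) \<xi> *v v) > 0"
proof -
  let ?d = "\<lambda>i. LINT \<eta>|lebesgue. heat_kernel_hess i i (\<xi> - \<eta>) * \<bar>\<eta> $ i\<bar> powr a"
  have "v \<bullet> (heat_hess (Phi a) \<xi> *v v) = (\<Sum>i\<in>UNIV. \<Sum>j\<in>UNIV. if i = j then (v $ i)\<^sup>2 * ?d i else 0)"
    unfolding inner_matrix_vector_mult_eq_sum heat_hess_def
    by (intro sum.cong refl) (simp add: heat_hess_integral_Phi assms power2_eq_square)
  also have "\<dots> = (\<Sum>i\<in>UNIV. (v $ i)\<^sup>2 * ?d i)" by simp
  also obtain i where "v $ i \<noteq> 0" using assms(3) by (auto simp: vec_eq_iff)
  then have "0 < (\<Sum>i\<in>UNIV. (v $ i)\<^sup>2 * ?d i)"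
    using heat_hess_integral_power_pos[OF assms(1,2)]
    by (intro sum_pos2[of _ i]) (auto intro!: mult_pos_pos mult_nonneg_nonneg simp: less_imp_le)
  finally show ?thesis .
qed

text \<open>\<open>X\<close> is an arbitrary bounded family without continuity in \<open>s\<close>,
  so failure of the claim is tested along sequences. With unit directions, points and directions lie
  in a compact product, and a limit pair would contradict \<open>heat_hess_Phi_pos\<close>.\<close>

lemma heat_hess_rescale_coercive:
  fixes f :: "real ^ 'n::finite \<Rightarrow> real" and X :: "real \<Rightarrow> real ^ 'n"
  assumes f: "f \<in> borel_measurable lebesgue" and lb: "quadratic_lower_bound f"
    and lp: "local_profile a f" and pt: "polynomial_tail f"
    and X: "\<And>s. 0 < s \<Longrightarrow> s \<le> 1 \<Longrightarrow> norm (X s) \<le> R"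
  shows "\<exists>s0 c0. 0 < s0 \<and> s0 \<le> 1 \<and> 0 < c0 \<and> (\<forall>s v. 0 < s \<longrightarrow> s < s0 \<longrightarrow>
    c0 * (norm v)\<^sup>2 \<le> v \<bullet> (heat_hess (rescale a f s) (X s) *v v))"
proof (rule ccontr)
  let ?Q = "\<lambda>s v. v \<bullet> (heat_hess (rescale a f s) (X s) *v v)"
  assume contr: "\<not> ?thesis"
  have a: "1 \<le> a" "a \<le> 2" using lp by (auto simp: local_profile_def)
  \<comment> \<open>The same number serves as the candidate for \<open>s0\<close> and for
    \<open>c0\<close>, so scale and quadratic form are driven to their limits together.\<close>
  let ?\<epsilon> = "\<lambda>k. inverse (real (Suc k))"
  have "\<exists>s v. 0 < s \<and> s < ?\<epsilon> k \<and> norm v = 1 \<and> ?Q s v < ?\<epsilon> k" for k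
  proof -
    have "0 < ?\<epsilon> k" "?\<epsilon> k \<le> 1" by (auto simp: field_simps)
    with contr have "\<not> (\<forall>s v. 0 < s \<longrightarrow> s < ?\<epsilon> k \<longrightarrow> ?\<epsilon> k * (norm v)\<^sup>2 \<le> ?Q s v)"
      by blast
    then obtain s v where sv: "0 < s" "s < ?\<epsilon> k" "?Q s v < ?\<epsilon> k * (norm v)\<^sup>2"
      unfolding not_all not_imp not_le by blast
    have "v \<noteq> 0" using sv(3) by auto
    define w where "w = (1 / norm v) *\<^sub>R v"
    have "?Q s w = ?Q s v / (norm v)\<^sup>2"
      by (simp add: w_def matrix_vector_mult_scaleR power2_eq_square)
    also have "\<dots> < ?\<epsilon> k" using sv(3) \<open>v \<noteq> 0\<close> by (simp add: pos_divide_less_eq)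
    finally show ?thesis using sv \<open>v \<noteq> 0\<close> by (intro exI[of _ s] exI[of _ w]) (auto simp: w_def)
  qed
  then obtain S V where SV: "\<And>k. 0 < S k" "\<And>k. S k < ?\<epsilon> k" "\<And>k. norm (V k) = 1" "\<And>k. ?Q (S k) (V k) < ?\<epsilon> k"
    by metis
  have S1: "S k \<le> 1" for k
    using SV(2)[of k] by (rule order_trans[OF less_imp_le]) (simp add: field_simps)
  have "seq_compact (cball (0 :: real ^ 'n) R \<times> sphere (0 :: real ^ 'n) 1)"
    by (intro compact_imp_seq_compact compact_Times) auto
  moreover have "\<forall>k. (X (S k), V k) \<in> cball 0 R \<times> sphere 0 1"
    using X SV(1,3) S1 by auto
  ultimately obtain p r where pr: "p \<in> cball 0 R \<times> sphere 0 1"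
    "strict_mono r" "((\<lambda>k. (X (S k), V k)) \<circ> r) \<longlonglongrightarrow> p"
    by (rule seq_compactE)
  obtain \<xi> v where p: "p = (\<xi>, v)" by (cases p)
  have Xr: "(\<lambda>k. X (S (r k))) \<longlonglongrightarrow> \<xi>" and Vr: "(\<lambda>k. V (r k)) \<longlonglongrightarrow> v"
    using tendsto_fst[OF pr(3)] tendsto_snd[OF pr(3)] by (auto simp: p comp_def)
  have \<epsilon>r: "(\<lambda>k. ?\<epsilon> (r k)) \<longlonglongrightarrow> 0"
    using LIMSEQ_subseq_LIMSEQ[OF LIMSEQ_inverse_real_of_nat pr(2)] by (simp add: comp_def)
  have Sr: "(\<lambda>k. S (r k)) \<longlonglongrightarrow> 0"
    by (rule tendsto_sandwich[OF _ _ tendsto_const \<epsilon>r])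
       (intro always_eventually allI less_imp_le SV)+
  obtain K m where Km: "2 \<le> m" "\<And>s y. 0 < s \<Longrightarrow> s \<le> 1 \<Longrightarrow> \<bar>rescale a f s y\<bar> \<le> K * (1 + norm y powr m)"
    using rescale_growth[OF lb lp pt] by blast
  have "(\<lambda>k. heat_hess (rescale a f (S (r k))) (X (S (r k))) $ i $ j) \<longlonglongrightarrow> heat_hess (Phi a) \<xi> $ i $ j" for i j
    unfolding heat_hess_def vec_lambda_beta
  proof (rule tendsto_heat_bounded_integral[OF heat_bounded_heat_kernel_hess _ _ _ _ _ Xr])
    show "rescale a f (S (r k)) \<in> borel_measurable lebesgue" for k
      by (intro rescale_measurable f SV)
    show "Phi a \<in> borel_measurable lebesgue" using a by (intro Phi_measurable) auto
    show "\<bar>rescale a f (S (r k)) y\<bar> \<le> K * (1 + norm y powr m)" for k y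
      by (intro Km SV S1)
    show "(\<lambda>k. rescale a f (S (r k)) y) \<longlonglongrightarrow> Phi a y" for y
      by (intro rescale_tendsto_Phi lb lp Sr SV)
  qed (use Km in auto)
  then have "(\<lambda>k. ?Q (S (r k)) (V (r k))) \<longlonglongrightarrow> v \<bullet> (heat_hess (Phi a) \<xi> *v v)"
    unfolding inner_matrix_vector_mult_eq_sum
    by (intro tendsto_sum tendsto_mult tendsto_vec_nth[OF Vr])
  then have "v \<bullet> (heat_hess (Phi a) \<xi> *v v) \<le> 0"
    using SV(4) by (intro LIMSEQ_le[OF _ \<epsilon>r]) (auto simp: less_imp_le)
  moreover have "v \<noteq> 0" using pr(1) by (auto simp: p)
  ultimately show False using heat_hess_Phi_pos[OF a, of v \<xi>] by simp
qed

section \<open>Return from the rescaled functions to the regularization of \<open>f\<close>\<close>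

lemma heat_reg_rescale:
  fixes f :: "real ^ 'n::finite \<Rightarrow> real"
  assumes "f \<in> borel_measurable lebesgue" "s > 0"
  shows "heat_reg 1 (rescale a f s) \<xi> = heat_reg (s\<^sup>2) f (s *\<^sub>R \<xi>) / s powr a"
  using heat_reg_scale[OF assms, of "s *\<^sub>R \<xi>"] assms(2)
  by (simp add: heat_reg_def rescale_def)

lemma hessian_heat_reg_rescale:
  fixes f :: "real ^ 'n::finite \<Rightarrow> real"
  assumes f: "f \<in> borel_measurable lebesgue" and s: "s > 0"
    and b: "\<And>y. \<bar>rescale a f s y\<bar> \<le> K * (1 + norm y powr m)" and m: "m \<ge> 0"
  shows "hessian (heat_reg (s\<^sup>2) f) x = (s powr a / s\<^sup>2) *\<^sub>R heat_hess (rescale a f s) ((1 / s) *\<^sub>R x)"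
proof -
  have fs: "f (s *\<^sub>R y) = s powr a * rescale a f s y" for y
    using s by (simp add: rescale_def)
  have "\<bar>f (s *\<^sub>R y)\<bar> \<le> (s powr a * K) * (1 + norm y powr m)" for y
    using mult_left_mono[OF b[of y], of "s powr a"] by (simp add: fs abs_mult mult.assoc)
  from hessian_heat_reg[OF f s this m] show ?thesis
    by (simp add: heat_hess_def fs vec_eq_iff mult.left_commute[of _ "s powr a"])
qed

text \<open>Compare the minimizer with the origin: there the rescaled regularization is at most
  \<open>M\<close>, by the growth bound and independently of \<open>s\<close>. Coercivity turns this
  value into a radius.\<close>

lemma rescaled_minimizers_bounded:
  fixes f :: "real ^ 'n::finite \<Rightarrow> real" and x :: "real \<Rightarrow> real ^ 'n"
  assumes f: "f \<in> borel_measurable lebesgue" and lb: "quadratic_lower_bound f"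
    and lp: "local_profile a f" and pt: "polynomial_tail f"
    and x: "\<And>t. t > 0 \<Longrightarrow> is_arg_min (heat_reg t f) (\<lambda>_. True) (x t)"
  shows "\<exists>R. \<forall>s. 0 < s \<longrightarrow> s \<le> 1 \<longrightarrow> norm ((1 / s) *\<^sub>R x (s\<^sup>2)) \<le> R"
proof -
  obtain K m where Km: "2 \<le> m" "\<And>s y. 0 < s \<Longrightarrow> s \<le> 1 \<Longrightarrow> \<bar>rescale a f s y\<bar> \<le> K * (1 + norm y powr m)"
    using rescale_growth[OF lb lp pt] by blast
  obtain k where k: "k > 0" "\<And>s y. 0 < s \<Longrightarrow> s \<le> 1 \<Longrightarrow> k * (norm y - real CARD('n)) \<le> rescale a f s y"
    using rescale_lower_bound[OF lb lp] by blast
  obtain \<gamma> \<beta> where \<gamma>: "\<gamma> > 0" and coercive: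
    "\<And>g (\<xi> :: real ^ 'n) K m. g \<in> borel_measurable lebesgue \<Longrightarrow> m \<ge> 0 \<Longrightarrow>
      (\<forall>y. \<bar>g y\<bar> \<le> K * (1 + norm y powr m)) \<Longrightarrow> (\<forall>y. k * (norm y - real CARD('n)) \<le> g y) \<Longrightarrow>
      \<gamma> * norm \<xi> - \<beta> \<le> heat_reg 1 g \<xi>"
    using heat_reg_coercive[OF k(1), of "real CARD('n)", where 'n = 'n] by blast
  define M where "M = heat_reg 1 (\<lambda>y :: real ^ 'n. K * (1 + norm y powr m)) 0"
  have m0: "m \<ge> 0" using Km by simp
  have K0: "K \<ge> 0" using order_trans[OF abs_ge_zero Km(2)[of 1 0]] by simp
  have "norm ((1 / s) *\<^sub>R x (s\<^sup>2)) \<le> (M + \<beta>) / \<gamma>" if s: "0 < s" "s \<le> 1" for s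
  proof -
    let ?g = "rescale a f s" and ?\<xi> = "(1 / s) *\<^sub>R x (s\<^sup>2)"
    have g: "?g \<in> borel_measurable lebesgue" using f s by (intro rescale_measurable)
    have "\<gamma> * norm ?\<xi> - \<beta> \<le> heat_reg 1 ?g ?\<xi>"
      using Km(2) k(2) s by (intro coercive[OF g m0, of K]) auto
    also have "\<dots> \<le> heat_reg 1 ?g 0"
    proof -
      have "heat_reg (s\<^sup>2) f (x (s\<^sup>2)) \<le> heat_reg (s\<^sup>2) f 0"
        using x[of "s\<^sup>2"] s by (simp add: is_arg_min_def not_less)
      then show ?thesis
        unfolding heat_reg_rescale[OF f s(1)] using s by (simp add: divide_right_mono)
    qed
    also have "\<dots> \<le> M"
      unfolding M_def heat_reg_def
    proof (rule integral_mono)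
      show "integrable lebesgue (\<lambda>y. heat_kernel 1 (0 - y) * ?g y)"
        by (rule integrable_heat_bounded[OF heat_bounded_heat_kernel g Km(2)[OF s] m0])
      show "integrable lebesgue (\<lambda>y :: real ^ 'n. heat_kernel 1 (0 - y) * (K * (1 + norm y powr m)))"
      proof (rule integrable_heat_bounded[OF heat_bounded_heat_kernel _ _ m0])
        show "(\<lambda>y :: real ^ 'n. K * (1 + norm y powr m)) \<in> borel_measurable lebesgue"
          by (intro borel_measurable_lebesgue_if_borel) measurable
        show "\<bar>K * (1 + norm y powr m)\<bar> \<le> K * (1 + norm y powr m)" for y :: "real ^ 'n"
          using K0 by (simp add: abs_mult add_nonneg_nonneg)
      qed
      show "heat_kernel 1 (0 - y) * ?g y \<le> heat_kernel 1 (0 - y) * (K * (1 + norm y powr m))" for y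
        using Km(2)[OF s, of y] by (intro mult_left_mono) (auto simp: heat_kernel_pos less_imp_le)
    qed
    finally show ?thesis using \<gamma> by (simp add: pos_le_divide_eq mult.commute)
  qed
  then show ?thesis by blast
qed

lemma transpose_heat_hess: "transpose (heat_hess g \<xi>) = heat_hess g \<xi>"
  by (simp add: transpose_def heat_hess_def vec_eq_iff heat_kernel_hess_commute)

theorem theorem4p7:
  fixes f :: "real ^ 'n::finite \<Rightarrow> real" and a :: real and x :: "real \<Rightarrow> real ^ 'n"
  assumes "f \<in> borel_measurable lebesgue"
    and "quadratic_lower_bound f"
    and "local_profile a f"
    and "polynomial_tail f"
    and "\<And>t. t > 0 \<Longrightarrow> is_arg_min (heat_reg t f) (\<lambda>_. True) (x t)"
  shows "\<exists>t0>0.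
      (\<forall>t. 0 < t \<and> t < t0 \<longrightarrow> pos_def (hessian (heat_reg t f) (x t))) \<and>
      (a = 2 \<longrightarrow> (\<exists>c0>0. \<forall>t. 0 < t \<and> t < t0 \<longrightarrow>
          hessian (heat_reg t f) (x t) \<succeq> c0 *\<^sub>R mat 1)) \<and>
      (1 \<le> a \<and> a < 2 \<longrightarrow> (\<exists>c0>0. \<forall>t. 0 < t \<and> t < t0 \<longrightarrow>
          hessian (heat_reg t f) (x t) \<succeq> (c0 * t powr ((a - 2) / 2)) *\<^sub>R mat 1))"
proof -
  obtain K m where Km: "2 \<le> m" "\<And>s y. 0 < s \<Longrightarrow> s \<le> 1 \<Longrightarrow> \<bar>rescale a f s y\<bar> \<le> K * (1 + norm y powr m)"
    using rescale_growth[OF assms(2-4)] by blast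
  define X where "X s = (1 / s) *\<^sub>R x (s\<^sup>2)" for s
  obtain R where R: "\<And>s. 0 < s \<Longrightarrow> s \<le> 1 \<Longrightarrow> norm (X s) \<le> R"
    using rescaled_minimizers_bounded[OF assms] unfolding X_def by blast
  obtain s0 c0 where s0: "0 < s0" "s0 \<le> 1" and c0: "0 < c0"
    and Q: "\<And>s v. 0 < s \<Longrightarrow> s < s0 \<Longrightarrow> c0 * (norm v)\<^sup>2 \<le> v \<bullet> (heat_hess (rescale a f s) (X s) *v v)"
    using heat_hess_rescale_coercive[OF assms(1-4), of X R] R by blast
  \<comment> \<open>One estimate of the quadratic form yields all the claims; symmetry is carried
    along because both notions of definiteness include it.\<close>
  have main: "transpose (hessian (heat_reg t f) (x t)) = hessian (heat_reg t f) (x t) \<and>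
      (\<forall>v. c0 * t powr ((a - 2) / 2) * (v \<bullet> v) \<le> v \<bullet> (hessian (heat_reg t f) (x t) *v v))"
    if t: "0 < t" "t < s0\<^sup>2" for t
  proof -
    define s where "s = sqrt t"
    have s: "0 < s" "s < s0" "s\<^sup>2 = t"
      using t s0 by (auto simp: s_def intro: real_less_lsqrt)
    have "s powr a = t powr (a / 2)"
      unfolding s_def using t by (subst powr_half_sqrt[symmetric]) (auto simp: powr_powr)
    moreover have "t powr ((a - 2) / 2) = t powr (a / 2) / t"
      using t by (simp add: diff_divide_distrib powr_diff)
    ultimately have scale: "s powr a / s\<^sup>2 = t powr ((a - 2) / 2)"
      by (simp add: s(3))
    have H: "hessian (heat_reg t f) (x t) = t powr ((a - 2) / 2) *\<^sub>R heat_hess (rescale a f s) (X s)"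
      using hessian_heat_reg_rescale[OF assms(1) s(1) Km(2), of "x t"] s s0 Km(1)
      unfolding X_def scale[symmetric] by simp
    have "c0 * t powr ((a - 2) / 2) * (v \<bullet> v) \<le> v \<bullet> (hessian (heat_reg t f) (x t) *v v)" for v
      using mult_left_mono[OF Q[OF s(1,2), of v], of "t powr ((a - 2) / 2)"]
      by (simp add: H scaleR_matrix_vector_assoc[symmetric] power2_norm_eq_inner mult_ac)
    moreover have "transpose (hessian (heat_reg t f) (x t)) = hessian (heat_reg t f) (x t)"
      unfolding H using transpose_heat_hess[of "rescale a f s" "X s"]
      by (simp add: transpose_scalar)
    ultimately show ?thesis by blast
  qed
  have loewner: "hessian (heat_reg t f) (x t) \<succeq> (c0 * t powr ((a - 2) / 2)) *\<^sub>R mat 1"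
    if "0 < t" "t < s0\<^sup>2" for t
  proof -
    have "transpose (A - c *\<^sub>R mat 1) = transpose A - c *\<^sub>R mat 1" for A :: "real ^ 'n ^ 'n" and c
      by (simp add: transpose_def mat_def vec_eq_iff)
    moreover have "v \<bullet> ((A - c *\<^sub>R mat 1) *v v) = v \<bullet> (A *v v) - c * (v \<bullet> v)"
      for A :: "real ^ 'n ^ 'n" and c v
      by (simp add: matrix_vector_mult_diff_rdistrib inner_diff_right flip: scaleR_matrix_vector_assoc)
    ultimately show ?thesis
      using main[OF that] by (simp add: loewner_ge_def pos_semidef_def)
  qed
  have pd: "pos_def (hessian (heat_reg t f) (x t))" if "0 < t" "t < s0\<^sup>2" for t
    unfolding pos_def_def
  proof (intro conjI allI impI)
    fix v :: "real ^ 'n" assume "v \<noteq> 0"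
    then have "0 < c0 * t powr ((a - 2) / 2) * (v \<bullet> v)" using c0 that by simp
    then show "0 < v \<bullet> (hessian (heat_reg t f) (x t) *v v)" using main[OF that] by (meson less_le_trans)
  qed (use main[OF that] in blast)
  show ?thesis
  \<comment> \<open>The bound on \<open>s = sqrt t\<close> becomes a bound on \<open>t\<close>,
    hence the square. For \<open>a = 2\<close> the exponent of \<open>t\<close> is 0, and the power
    equals 1 because \<open>t > 0\<close>.\<close>
  proof (rule exI[of _ "s0\<^sup>2"], intro conjI impI)
    show "0 < s0\<^sup>2" using s0 by simp
    show "\<forall>t. 0 < t \<and> t < s0\<^sup>2 \<longrightarrow> pos_def (hessian (heat_reg t f) (x t))" using pd by blast
    show "\<exists>c0>0. \<forall>t. 0 < t \<and> t < s0\<^sup>2 \<longrightarrow> hessian (heat_reg t f) (x t) \<succeq> c0 *\<^sub>R mat 1" if "a = 2"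
      using loewner c0 that by (intro exI[of _ c0]) auto
    show "\<exists>c0>0. \<forall>t. 0 < t \<and> t < s0\<^sup>2 \<longrightarrow>
        hessian (heat_reg t f) (x t) \<succeq> (c0 * t powr ((a - 2) / 2)) *\<^sub>R mat 1"
      using loewner c0 by blast
  qed
qed

end
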